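(* For every $n\ge1$ the following equidistributions hold: (i) $LS(13/2/4)\sim RB(1/24/3)$; (ii) $RB(13/2/4)\sim LS(1/24/3)$; (iii) $LB(13/2/4)\sim LB(1/24/3)$; (iv) $RS(13/2/4)\sim RS(1/24/3)$. Here, for $\mathrm{st}\in\{ls,lb,rs,rb\}$ with corresponding capital letters $ST\in\{LS,LB,RS,RB\}$, $ST(\pi)\sim ST'(\pi')$ means that for every integer $k$, the number of $w\in R_n(\pi)$ with $\mathrm{st}(w)=k$ equals the number of $w\in R_n(\pi')$ with $\mathrm{st}'(w)=k$.
   Context: A set partition $\sigma$ of $[n]=\{1,\dots,n\}$ is written $\sigma=B_1/B_2/\dots/B_m$ with blocks ordered so that $\min B_1<\dots<\min B_m$. For $A\subseteq[n]$, the subpartition $A\cap\sigma$ is the set partition of $A$ formed by the nonempty sets $A\cap B_i$; it is standardized by replacing its smallest element by $1$, the next smallest by $2$, and so on. $\sigma$ contains a pattern $\pi$ (a set partition of some $[k]$) if some subpartition of $\sigma$ standardizes to $\pi$; otherwise $\sigma$ avoids $\pi$. $\Pi_n(\pi)$ is the set of set partitions of $[n]$ avoiding $\pi$. To $\sigma=B_1/\dots/B_m$ corresponds the word (restricted growth function) $w(\sigma)=w_1\cdots w_n$ with $w_i=j$ if $i\in B_j$. $R_n(\pi)=\{w(\sigma):\sigma\in\Pi_n(\pi)\}$. Wachs and White statistics: for a word $w=w_1\cdots w_n$ and position $i$, let (counting distinct letter values) $rs_i(w)=|\{w_j: j>i,\ w_j<w_i\}|$, $ls_i(w)=|\{w_j: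 j<i,\ w_j<w_i\}|$, $lb_i(w)=|\{w_j: j<i,\ w_j>w_i\}|$, $rb_i(w)=|\{w_j: j>i,\ w_j>w_i\}|$; and $rs(w)=\sum_i rs_i(w)$, $ls(w)=\sum_i ls_i(w)$, $lb(w)=\sum_i lb_i(w)$, $rb(w)=\sum_i rb_i(w)$. The pattern $13/2/4$ is the set partition $\{1,3\},\{2\},\{4\}$ of $[4]$, and $1/24/3$ is $\{1\},\{2,4\},\{3\}$. *)

theory Defs
  imports "HOL-Library.Disjoint_Sets"
begin

text \<open>A set partition of \<open>[n]\<close> is a set of blocks \<open>\<sigma> :: nat set set\<close> with
  \<^term>\<open>partition_on {1..n} \<sigma>\<close>.\<close>

definition subpartition :: "nat set \<Rightarrow> nat set set \<Rightarrow> nat set set" where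
  "subpartition A \<sigma> = (\<lambda>B. A \<inter> B) ` \<sigma> - {{}}"

text \<open>The \<open>k\<close>-th smallest element of \<open>\<Union>\<sigma>\<close> is replaced by \<open>k\<close>.\<close>

definition standardize :: "nat set set \<Rightarrow> nat set set" where
  "standardize \<sigma> = (\<lambda>B. (\<lambda>x. card {y \<in> \<Union>\<sigma>. y \<le> x}) ` B) ` \<sigma>"

definition contains_pattern :: "nat set set \<Rightarrow> nat set set \<Rightarrow> bool" where
  "contains_pattern \<sigma> \<pi> \<longleftrightarrow> (\<exists>A \<subseteq> \<Union>\<sigma>. standardize (subpartition A \<sigma>) = \<pi>)"

definition avoiding_partitions :: "nat \<Rightarrow> nat set set \<Rightarrow> nat set set set" where
  "avoiding_partitions n \<pi> = {\<sigma>. partition_on {1..n} \<sigma> \<and> \<not> contains_pattern \<sigma> \<pi>}"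

definition blocks :: "nat set set \<Rightarrow> nat set list" where
  "blocks \<sigma> = (THE bs. set bs = \<sigma> \<and> sorted_wrt (\<lambda>B C. Min B < Min C) bs)"

text \<open>Letters are numbered from 1, whereas list positions start at 0: the letter \<open>w\<^sub>i\<close> of the
  informal notation is \<open>w ! (i - 1)\<close>, and the block \<open>B\<^sub>j\<close> is \<open>blocks \<sigma> ! (j - 1)\<close>.\<close>

definition rgf :: "nat \<Rightarrow> nat set set \<Rightarrow> nat list" where
  "rgf n \<sigma> = map (\<lambda>i. THE j. j \<in> {1..length (blocks \<sigma>)} \<and> i \<in> blocks \<sigma> ! (j - 1)) [1..<n + 1]"

definition avoiding_rgfs :: "nat \<Rightarrow> nat set set \<Rightarrow> nat list set" where
  "avoiding_rgfs n \<pi> = rgf n ` avoiding_partitions n \<pi>"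

definition rs_at :: "nat list \<Rightarrow> nat \<Rightarrow> nat" where
  "rs_at w i = card {w ! j | j. j < length w \<and> j > i \<and> w ! j < w ! i}"

definition ls_at :: "nat list \<Rightarrow> nat \<Rightarrow> nat" where
  "ls_at w i = card {w ! j | j. j < i \<and> w ! j < w ! i}"

definition lb_at :: "nat list \<Rightarrow> nat \<Rightarrow> nat" where
  "lb_at w i = card {w ! j | j. j < i \<and> w ! j > w ! i}"

definition rb_at :: "nat list \<Rightarrow> nat \<Rightarrow> nat" where
  "rb_at w i = card {w ! j | j. j < length w \<and> j > i \<and> w ! j > w ! i}"

definition rs :: "nat list \<Rightarrow> nat" where "rs w = (\<Sum>i<length w. rs_at w i)"
definition ls :: "nat list \<Rightarrow> nat" where "ls w = (\<Sum>i<length w. ls_at w i)"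
definition lb :: "nat list \<Rightarrow> nat" where "lb w = (\<Sum>i<length w. lb_at w i)"
definition rb :: "nat list \<Rightarrow> nat" where "rb w = (\<Sum>i<length w. rb_at w i)"

definition equidistributed ::
    "nat \<Rightarrow> (nat list \<Rightarrow> nat) \<Rightarrow> nat set set \<Rightarrow> (nat list \<Rightarrow> nat) \<Rightarrow> nat set set \<Rightarrow> bool" where
  "equidistributed n st \<pi> st' \<pi>' \<longleftrightarrow>
     (\<forall>k::int. card {w \<in> avoiding_rgfs n \<pi>. int (st w) = k}
             = card {w \<in> avoiding_rgfs n \<pi>'. int (st' w) = k})"

abbreviation pat_13_2_4 :: "nat set set" where "pat_13_2_4 \<equiv> {{1, 3}, {2}, {4}}"
abbreviation pat_1_24_3 :: "nat set set" where "pat_1_24_3 \<equiv> {{1}, {2, 4}, {3}}"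

text \<open>The description in \<^const>\<open>blocks\<close> determines a unique list.\<close>

lemma blocks_unique:
  assumes "set bs = \<sigma>" "sorted_wrt (\<lambda>B C. Min B < Min C) bs"
  shows "blocks \<sigma> = bs"
  unfolding blocks_def
proof (rule the_equality)
  fix cs :: "nat set list"
  assume cs: "set cs = \<sigma> \<and> sorted_wrt (\<lambda>B C. Min B < Min C) cs"
  have "sorted_wrt (<) (map Min cs)" "sorted_wrt (<) (map Min bs)"
    using cs assms(2) by (simp_all add: sorted_wrt_map)
  moreover have "set (map Min cs) = set (map Min bs)" using cs assms(1) by simp
  ultimately have eq: "map Min cs = map Min bs"
    using strict_sorted_equal by blast
  have "inj_on Min (set bs)"
    using \<open>sorted_wrt (<) (map Min bs)\<close> strict_sorted_iff distinct_map by blast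
  then show "cs = bs"
    using eq cs assms(1) by (auto simp: inj_on_def intro: map_inj_on[of Min])
qed (use assms in auto)

lemma blocks_partition:
  assumes "partition_on {1..n} \<sigma>"
  shows "set (blocks \<sigma>) = \<sigma>" "sorted_wrt (\<lambda>B C. Min B < Min C) (blocks \<sigma>)"
proof -
  have fin: "finite \<sigma>" using assms finite_elements by blast
  have mem: "Min B \<in> B" if "B \<in> \<sigma>" for B
  proof (rule Min_in)
    have "B \<subseteq> {1..n}" using that partition_onD1[OF assms] by blast
    then show "finite B" using finite_subset by blast
    show "B \<noteq> {}" using that partition_onD3[OF assms] by blast
  qed
  have inj: "inj_on Min \<sigma>"
  proof (rule inj_onI)
    fix B C assume "B \<in> \<sigma>" "C \<in> \<sigma>" "Min B = Min C"
    then have "Min B \<in> B \<inter> C" using mem[of B] mem[of C] by simp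
    then show "B = C"
      using disjointD[OF partition_onD2[OF assms] \<open>B \<in> \<sigma>\<close> \<open>C \<in> \<sigma>\<close>] by blast
  qed
  define bs where "bs = map (the_inv_into \<sigma> Min) (sorted_list_of_set (Min ` \<sigma>))"
  have set: "set bs = \<sigma>"
    using fin inj by (simp add: bs_def)
  have "map Min bs = sorted_list_of_set (Min ` \<sigma>)"
    unfolding bs_def using fin inj by (auto simp: f_the_inv_into_f intro!: map_idI)
  then have "sorted_wrt (<) (map Min bs)" by simp
  then have sorted: "sorted_wrt (\<lambda>B C. Min B < Min C) bs" by (simp add: sorted_wrt_map)
  show "set (blocks \<sigma>) = \<sigma>" "sorted_wrt (\<lambda>B C. Min B < Min C) (blocks \<sigma>)"
    using blocks_unique[OF set sorted] set sorted by simp_all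
qed

end

theory Submission
  imports Defs "HOL-Library.Sublist"
begin

text \<open>Write \<open>a \<oplus> b\<close> for the word \<open>a\<close> followed by \<open>b\<close> shifted above the letters of \<open>a\<close>. A restricted
  growth function avoids \<open>13/2/4\<close> exactly when it is \<open>r \<oplus> u\<close>, and avoids \<open>1/24/3\<close> exactly when it is
  \<open>u \<oplus> r\<close>, where \<open>r\<close> is weakly increasing and \<open>u = s 1\<^sup>k\<close> with \<open>s\<close> weakly increasing or binary; the
  decomposition is unique once \<open>u\<close> is required to be empty, or unsorted and irreducible for \<open>\<oplus>\<close>. Both \<open>lb\<close> and \<open>rs\<close> are
  additive over \<open>\<oplus>\<close>, so exchanging the summands proves (iii) and (iv). Reverse complementation of a
  word exchanges \<open>ls\<close> and \<open>rb\<close>; exchanging the summands while replacing \<open>r\<close> and \<open>s\<close> by their reverse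
  complements proves (i) and (ii).\<close>

section \<open>The statistics of a concatenation\<close>

text \<open>The shape \<open>s\<close> followed by ones comes from looking at a single descent. At a
  descent to \<open>x\<close> from a prefix that already contains \<open>x\<close> and a larger
  \<open>y\<close>, the letters \<open>x\<close>, \<open>y\<close>, \<open>x\<close> are in place,
  so avoiding \<open>13/2/4\<close> confines all later letters to \<open>x\<close> and
  \<open>y\<close>. Two choices of \<open>y\<close> leave only \<open>x\<close>, hence a constant
  tail; one choice leaves a two-letter word. For \<open>1/24/3\<close> the restrictions act on what
  precedes the last descent and on the letters after it that are not above the whole prefix. The
  trailing ones stay outside the reverse complementation because reversing and complementing all of
  \<open>s @ replicate k 1\<close> with \<open>k > 0\<close> would put the greatest letter first and
  destroy restricted growth. Leaving them alone costs nothing: trailing least letters change neither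
  \<open>ls\<close> nor \<open>rb\<close>.\<close>

lemma nat_ex_iff: "(\<exists>j. P j) \<longleftrightarrow> P 0 \<or> (\<exists>j. P (Suc j))" for P :: "nat \<Rightarrow> bool"
  by (metis not0_implies_Suc)

lemma rs_Cons: "rs (x # w) = card {y \<in> set w. y < x} + rs w"
proof -
  have "rs (x # w) = rs_at (x # w) 0 + (\<Sum>i<length w. rs_at (x # w) (Suc i))"
    by (simp add: rs_def sum.lessThan_Suc_shift del: sum.lessThan_Suc)
  moreover have "{(x # w) ! j |j. j < length (x # w) \<and> j > 0 \<and> (x # w) ! j < (x # w) ! 0} = {y \<in> set w. y < x}"
    by (subst nat_ex_iff) (auto simp: in_set_conv_nth)
  moreover have "rs_at (x # w) (Suc i) = rs_at w i" for i
    unfolding rs_at_def by (subst nat_ex_iff) simp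
  ultimately show ?thesis by (simp add: rs_def rs_at_def)
qed

lemma rb_Cons: "rb (x # w) = card {y \<in> set w. x < y} + rb w"
proof -
  have "rb (x # w) = rb_at (x # w) 0 + (\<Sum>i<length w. rb_at (x # w) (Suc i))"
    by (simp add: rb_def sum.lessThan_Suc_shift del: sum.lessThan_Suc)
  moreover have "{(x # w) ! j |j. j < length (x # w) \<and> j > 0 \<and> (x # w) ! j > (x # w) ! 0} = {y \<in> set w. x < y}"
    by (subst nat_ex_iff) (auto simp: in_set_conv_nth)
  moreover have "rb_at (x # w) (Suc i) = rb_at w i" for i
    unfolding rb_at_def by (subst nat_ex_iff) simp
  ultimately show ?thesis by (simp add: rb_def rb_at_def)
qed

text \<open>\<open>ls\<close> and \<open>lb\<close> look to the left, so a letter appended on the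
  right leaves the earlier summands alone; their recursion therefore peels the last letter, while
  that of \<open>rs\<close> and \<open>rb\<close> peels the first.\<close>

lemma ls_snoc: "ls (w @ [x]) = ls w + card {y \<in> set w. y < x}"
proof -
  have "ls_at (w @ [x]) i = ls_at w i" if "i < length w" for i
    unfolding ls_at_def
    by (intro arg_cong[where f = card] Collect_cong ex_cong1) (use that in \<open>auto simp: nth_append\<close>)
  moreover have "{(w @ [x]) ! j |j. j < length w \<and> (w @ [x]) ! j < x} = {y \<in> set w. y < x}"
    by (auto simp: in_set_conv_nth nth_append cong: conj_cong)
  ultimately show ?thesis by (simp add: ls_def ls_at_def)
qed

lemma lb_snoc: "lb (w @ [x]) = lb w + card {y \<in> set w. x < y}"
proof -
  have "lb_at (w @ [x]) i = lb_at w i" if "i < length w" for i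
    unfolding lb_at_def
    by (intro arg_cong[where f = card] Collect_cong ex_cong1) (use that in \<open>auto simp: nth_append\<close>)
  moreover have "{(w @ [x]) ! j |j. j < length w \<and> (w @ [x]) ! j > x} = {y \<in> set w. x < y}"
    by (auto simp: in_set_conv_nth nth_append cong: conj_cong)
  ultimately show ?thesis by (simp add: lb_def lb_at_def)
qed

lemma stat_Nil [simp]: "rs [] = 0" "rb [] = 0" "ls [] = 0" "lb [] = 0"
  by (simp_all add: rs_def rb_def ls_def lb_def)

lemma card_Collect_map:
  assumes "inj_on f (set w)" "\<And>y. y \<in> set w \<Longrightarrow> P (f y) \<longleftrightarrow> Q y"
  shows "card {y \<in> f ` set w. P y} = card {y \<in> set w. Q y}"
proof -
  have "{y \<in> f ` set w. P y} = f ` {y \<in> set w. Q y}" using assms(2) by auto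
  then show ?thesis
    using card_image[of f "{y \<in> set w. Q y}"] assms(1) by (auto intro: inj_on_subset)
qed

lemma stat_map_strict_mono:
  assumes "strict_mono (f :: nat \<Rightarrow> nat)"
  shows "rs (map f w) = rs w" "rb (map f w) = rb w" "ls (map f w) = ls w" "lb (map f w) = lb w"
proof -
  note strict_mono_less[OF assms, simp]
  have [simp]: "inj_on f S" for S using assms strict_mono_imp_inj_on by (meson inj_on_subset subset_UNIV)
  show "rs (map f w) = rs w" "rb (map f w) = rb w"
    by (induction w) (auto simp: rs_Cons rb_Cons intro!: card_Collect_map)
  show "ls (map f w) = ls w" "lb (map f w) = lb w"
    by (induction w rule: rev_induct) (auto simp: ls_snoc lb_snoc intro!: card_Collect_map)
qed

text \<open>Reversal exchanges left with right, and \<open>c - x\<close> exchanges smaller with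
  larger. The bound on the letters makes truncated subtraction an involution, hence
  injective.\<close>

lemma rb_rev_compl:
  assumes "\<forall>x\<in>set w. x \<le> c"
  shows "rb (rev (map (\<lambda>x. c - x) w)) = ls w"
  using assms
proof (induction w rule: rev_induct)
  case (snoc x w)
  then have "card {y \<in> (\<lambda>x. c - x) ` set w. c - x < y} = card {y \<in> set w. y < x}"
    by (intro card_Collect_map inj_on_inverseI[where g = "\<lambda>x. c - x"]) auto
  with snoc show ?case by (simp add: rb_Cons ls_snoc)
qed simp

lemma ls_rev_compl:
  assumes "\<forall>x\<in>set w. x \<le> c"
  shows "ls (rev (map (\<lambda>x. c - x) w)) = rb w"
  using assms
proof (induction w)
  case (Cons x w)
  then have "card {y \<in> (\<lambda>x. c - x) ` set w. y < c - x} = card {y \<in> set w. x < y}"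
    by (intro card_Collect_map inj_on_inverseI[where g = "\<lambda>x. c - x"]) auto
  with Cons show ?case by (simp add: rb_Cons ls_snoc)
qed simp

lemma rs_append_less:
  assumes "\<And>x y. x \<in> set a \<Longrightarrow> y \<in> set b \<Longrightarrow> x < y"
  shows "rs (a @ b) = rs a + rs b"
  using assms
proof (induction a)
  case (Cons x a)
  then have "{y \<in> set (a @ b). y < x} = {y \<in> set a. y < x}" by force
  with Cons show ?case by (simp add: rs_Cons)
qed simp

lemma lb_append_less:
  assumes "\<And>x y. x \<in> set a \<Longrightarrow> y \<in> set b \<Longrightarrow> x < y"
  shows "lb (a @ b) = lb a + lb b"
  using assms
proof (induction b rule: rev_induct)
  case (snoc x b)
  then have "{y \<in> set (a @ b). x < y} = {y \<in> set b. x < y}" by force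
  moreover have "lb (a @ b) = lb a + lb b" using snoc by simp
  ultimately show ?case using lb_snoc[of "a @ b" x] by (simp add: lb_snoc)
qed simp

text \<open>Each position of \<open>a\<close> sees every distinct letter of \<open>b\<close> as
  larger and to its right, which gives the cross term.\<close>

lemma rb_append_less:
  assumes "\<And>x y. x \<in> set a \<Longrightarrow> y \<in> set b \<Longrightarrow> x < y"
  shows "rb (a @ b) = rb a + length a * card (set b) + rb b"
  using assms
proof (induction a)
  case (Cons x a)
  then have "{y \<in> set (a @ b). x < y} = {y \<in> set a. x < y} \<union> set b" by force
  moreover have "{y \<in> set a. x < y} \<inter> set b = {}" using Cons.prems by force
  ultimately have "card {y \<in> set (a @ b). x < y} = card {y \<in> set a. x < y} + card (set b)"
    by (simp add: card_Un_disjoint)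
  with Cons show ?case by (simp add: rb_Cons)
qed simp

lemma ls_append_less:
  assumes "\<And>x y. x \<in> set a \<Longrightarrow> y \<in> set b \<Longrightarrow> x < y"
  shows "ls (a @ b) = ls a + card (set a) * length b + ls b"
  using assms
proof (induction b rule: rev_induct)
  case (snoc x b)
  then have "{y \<in> set (a @ b). y < x} = set a \<union> {y \<in> set b. y < x}" by force
  moreover have "set a \<inter> {y \<in> set b. y < x} = {}" using snoc.prems by force
  ultimately have "card {y \<in> set (a @ b). y < x} = card (set a) + card {y \<in> set b. y < x}"
    by (simp add: card_Un_disjoint)
  moreover have "ls (a @ b) = ls a + card (set a) * length b + ls b" using snoc by simp
  ultimately show ?case using ls_snoc[of "a @ b" x] by (simp add: ls_snoc)
qed simp

text \<open>A trailing least letter exceeds nothing before it and has nothing larger after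
  it.\<close>

lemma rb_append_replicate_least:
  assumes "\<forall>x\<in>set s. c \<le> x"
  shows "rb (s @ replicate k c) = rb s"
  using assms
proof (induction s)
  case Nil
  show ?case by (induction k) (auto simp: rb_Cons)
next
  case (Cons x s)
  then have "{y \<in> set (s @ replicate k c). x < y} = {y \<in> set s. x < y}" by auto
  with Cons show ?case by (simp add: rb_Cons)
qed

lemma ls_append_replicate_least:
  assumes "\<forall>x\<in>set s. c \<le> x"
  shows "ls (s @ replicate k c) = ls s"
proof (induction k)
  case (Suc k)
  have "{y \<in> set (s @ replicate k c). y < c} = {}" using assms by auto
  with Suc show ?case
    using ls_snoc[of "s @ replicate k c" c] by (simp flip: replicate_append_same)
qed simp

section \<open>Pattern containment in restricted growth functions\<close>

text \<open>Partitions are compared through this relation because it turns into equality of letters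
  once a partition is replaced by its word.\<close>

definition same_block :: "nat set set \<Rightarrow> nat \<Rightarrow> nat \<Rightarrow> bool" where
  "same_block \<sigma> i j \<longleftrightarrow> (\<exists>B\<in>\<sigma>. i \<in> B \<and> j \<in> B)"

lemma partition_on_eqI:
  assumes P: "partition_on A P" and Q: "partition_on A Q"
    and same: "\<And>i j. i \<in> A \<Longrightarrow> j \<in> A \<Longrightarrow> same_block P i j \<longleftrightarrow> same_block Q i j"
  shows "P = Q"
proof -
  have block: "B = {j \<in> A. same_block R i j}" if "partition_on A R" "B \<in> R" "i \<in> B" for R B i
    using that partition_onD1[OF that(1)] disjointD[OF partition_onD2[OF that(1)]]
    unfolding same_block_def by blast
  have "R \<subseteq> S" if R: "partition_on A R" and S: "partition_on A S"
    and same: "\<And>i j. i \<in> A \<Longrightarrow> j \<in> A \<Longrightarrow> same_block R i j \<longleftrightarrow> same_block S i j" for R S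
  proof
    fix B assume B: "B \<in> R"
    then have "B \<noteq> {}" using partition_onD3[OF R] by metis
    then obtain i where i: "i \<in> B" "i \<in> A"
      using partition_onD1[OF R] B by blast
    then obtain C where C: "C \<in> S" "i \<in> C" using partition_onD1[OF S] by blast
    have "B = C" using block[OF R B i(1)] block[OF S C] same i(2) by auto
    then show "B \<in> S" using C by simp
  qed
  then show ?thesis using assms by (meson equalityI)
qed

text \<open>Identifies the rank used by \<open>standardize\<close> with the list index; ranks start
  at 1 and indices at 0.\<close>

lemma card_le_nth_sorted:
  assumes "sorted_wrt (<) xs" "i < length (xs :: nat list)"
  shows "card {y \<in> set xs. y \<le> xs ! i} = Suc i"
proof -
  have "{y \<in> set xs. y \<le> xs ! i} = (!) xs ` {..i}"
  proof (intro equalityI subsetI)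
    fix y assume "y \<in> {y \<in> set xs. y \<le> xs ! i}"
    then obtain j where "j < length xs" "y = xs ! j" "xs ! j \<le> xs ! i" by (auto simp: in_set_conv_nth)
    moreover have "j \<le> i"
      using calculation assms sorted_wrt_nth_less[OF assms(1), of i j] by (meson leD leI)
    ultimately show "y \<in> (!) xs ` {..i}" by auto
  next
    fix y assume "y \<in> (!) xs ` {..i}"
    then obtain j where "j \<le> i" "y = xs ! j" by auto
    then show "y \<in> {y \<in> set xs. y \<le> xs ! i}"
      using assms sorted_wrt_nth_less[OF assms(1), of j i] by (cases "j = i") auto
  qed
  moreover have "inj_on ((!) xs) {..i}"
    using assms by (intro inj_on_nth) (auto simp: strict_sorted_iff)
  ultimately show ?thesis by (simp add: card_image)
qed

lemma Union_subpartition: "A \<subseteq> \<Union>\<sigma> \<Longrightarrow> \<Union>(subpartition A \<sigma>) = A"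
  unfolding subpartition_def by blast

lemma Bex_subpartition: "(\<exists>B\<in>subpartition A \<sigma>. P B) \<longleftrightarrow> (\<exists>B\<in>\<sigma>. A \<inter> B \<noteq> {} \<and> P (A \<inter> B))"
  by (auto simp: subpartition_def)

lemma same_block_standardize:
  assumes xs: "sorted_wrt (<) xs" "set xs \<subseteq> \<Union>\<sigma>" and ij: "i < length xs" "j < length xs"
  shows "same_block (standardize (subpartition (set xs) \<sigma>)) (Suc i) (Suc j)
    \<longleftrightarrow> same_block \<sigma> (xs ! i) (xs ! j)" (is "?L \<longleftrightarrow> ?R")
proof -
  let ?rank = "\<lambda>x. card {y \<in> set xs. y \<le> x}"
  have rank: "Suc i \<in> ?rank ` (set xs \<inter> B) \<longleftrightarrow> xs ! i \<in> B" if "i < length xs" for i B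
  proof
    assume "Suc i \<in> ?rank ` (set xs \<inter> B)"
    then obtain x where x: "x \<in> set xs" "x \<in> B" "Suc i = ?rank x" by blast
    then obtain j where "j < length xs" "x = xs ! j" by (auto simp: in_set_conv_nth)
    with x show "xs ! i \<in> B" using card_le_nth_sorted[OF xs(1)] by simp
  next
    assume "xs ! i \<in> B"
    then show "Suc i \<in> ?rank ` (set xs \<inter> B)"
      using card_le_nth_sorted[OF xs(1) that] that by (auto intro!: image_eqI[of _ _ "xs ! i"])
  qed
  have "?L \<longleftrightarrow> (\<exists>B\<in>subpartition (set xs) \<sigma>. Suc i \<in> ?rank ` B \<and> Suc j \<in> ?rank ` B)"
    unfolding same_block_def standardize_def Union_subpartition[OF xs(2)] by (simp only: bex_simps)
  \<comment> \<open>\<open>subpartition\<close> discards empty traces, but a trace whose image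
    contains \<open>Suc i\<close> is nonempty anyway.\<close>
  also have "\<dots> \<longleftrightarrow> (\<exists>B\<in>\<sigma>. Suc i \<in> ?rank ` (set xs \<inter> B) \<and> Suc j \<in> ?rank ` (set xs \<inter> B))"
    unfolding Bex_subpartition by (intro bex_cong refl) (metis image_empty empty_iff)
  also have "\<dots> \<longleftrightarrow> ?R"
    using rank ij by (simp add: same_block_def)
  finally show ?thesis .
qed

lemma partition_on_standardize_subpartition:
  assumes \<sigma>: "partition_on S \<sigma>" and xs: "sorted_wrt (<) xs" "set xs \<subseteq> S"
  shows "partition_on {1..length xs} (standardize (subpartition (set xs) \<sigma>))"
proof -
  let ?rank = "\<lambda>x. card {y \<in> set xs. y \<le> x}"
  have nth: "?rank (xs ! i) = Suc i" if "i < length xs" for i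
    using card_le_nth_sorted[OF xs(1) that] .
  have sub: "partition_on (set xs) (subpartition (set xs) \<sigma>)"
    using partition_on_restrict[OF \<sigma>, of "set xs"] xs(2)
    by (simp add: subpartition_def Int_absorb2)
  have "inj_on ?rank (set xs)"
    using nth by (auto simp: inj_on_def in_set_conv_nth)
  then have "partition_on (?rank ` set xs) ((`) ?rank ` subpartition (set xs) \<sigma> - {{}})"
    using partition_on_inj_image[OF sub] by blast
  moreover have "(`) ?rank ` subpartition (set xs) \<sigma> - {{}} = standardize (subpartition (set xs) \<sigma>)"
    using partition_onD1[OF sub] partition_onD3[OF sub] by (auto simp: standardize_def)
  moreover have "?rank ` set xs = {1..length xs}"
  proof -
    have "set xs = (!) xs ` {..<length xs}" by (auto simp: in_set_conv_nth)
    then have "?rank ` set xs = (\<lambda>i. ?rank (xs ! i)) ` {..<length xs}" by (metis image_image)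
    also have "\<dots> = Suc ` {..<length xs}" using nth by simp
    finally show ?thesis by (simp add: lessThan_atLeast0 image_Suc_atLeastLessThan atLeastLessThanSuc_atLeastAtMost)
  qed
  ultimately show ?thesis by simp
qed

text \<open>Listing \<open>A\<close> increasingly turns standardization into indexing, and a
  partition of \<open>{1..k}\<close> is determined by its \<open>same_block\<close> relation; so
  containment asks for \<open>k\<close> elements that realize the relation of the pattern.\<close>

lemma contains_pattern_iff:
  assumes \<sigma>: "partition_on S \<sigma>" and \<pi>: "partition_on {1..k} \<pi>"
  shows "contains_pattern \<sigma> \<pi> \<longleftrightarrow>
    (\<exists>xs. sorted_wrt (<) xs \<and> set xs \<subseteq> S \<and> length xs = k
      \<and> (\<forall>i<k. \<forall>j<k. same_block \<sigma> (xs ! i) (xs ! j) \<longleftrightarrow> same_block \<pi> (Suc i) (Suc j)))"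
    (is "_ \<longleftrightarrow> (\<exists>xs. ?P xs)")
proof
  have U: "\<Union>\<sigma> = S" using partition_onD1[OF \<sigma>] by simp
  assume "contains_pattern \<sigma> \<pi>"
  then obtain A where A: "A \<subseteq> S" and std: "standardize (subpartition A \<sigma>) = \<pi>"
    unfolding contains_pattern_def U by blast
  have UA: "\<Union>(subpartition A \<sigma>) = A" using A U by (intro Union_subpartition) simp
  let ?rank = "\<lambda>x. card {y \<in> A. y \<le> x}"
  \<comment> \<open>\<open>S\<close> may be infinite; both the finiteness and the size of
    \<open>A\<close> come from the rank map, which is injective on \<open>A\<close> with image
    \<open>{1..k}\<close>.\<close>
  have "?rank ` A = \<Union>(standardize (subpartition A \<sigma>))"
    unfolding standardize_def UA by (subst UA[symmetric], rule image_Union)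
  then have rank: "?rank ` A = {1..k}"
    using std partition_onD1[OF \<pi>] by simp
  have "?rank x < ?rank y" if "x \<in> A" "y \<in> A" "x < y" for x y
  proof (rule psubset_card_mono)
    have "y \<in> {z \<in> A. z \<le> y} - {z \<in> A. z \<le> x}" using that by simp
    moreover have "{z \<in> A. z \<le> x} \<subseteq> {z \<in> A. z \<le> y}" using that by auto
    ultimately show "{z \<in> A. z \<le> x} \<subset> {z \<in> A. z \<le> y}" by blast
  qed simp
  then have inj: "inj_on ?rank A" by (intro linorder_inj_onI' less_imp_neq)
  then have "finite A" using finite_imageD[OF _ inj] rank by simp
  define xs where "xs = sorted_list_of_set A"
  have xs: "sorted_wrt (<) xs" "set xs = A" using \<open>finite A\<close> by (auto simp: xs_def)
  have "length xs = k"
    using card_image[OF inj] rank by (simp add: xs_def)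
  then have "?P xs"
    using same_block_standardize[of xs \<sigma>] std xs A U by auto
  then show "\<exists>xs. ?P xs" ..
next
  assume "\<exists>xs. ?P xs"
  then obtain xs where xs: "?P xs" ..
  have U: "\<Union>\<sigma> = S" using partition_onD1[OF \<sigma>] by simp
  have "standardize (subpartition (set xs) \<sigma>) = \<pi>"
  proof (rule partition_on_eqI)
    show "partition_on {1..k} (standardize (subpartition (set xs) \<sigma>))"
      using partition_on_standardize_subpartition[OF \<sigma>] xs by blast
    fix i j assume "i \<in> {1..k}" "j \<in> {1..k}"
    then show "same_block (standardize (subpartition (set xs) \<sigma>)) i j \<longleftrightarrow> same_block \<pi> i j"
      using same_block_standardize[of xs \<sigma> "i - 1" "j - 1"] xs U
      by (auto simp: Suc_le_eq dest!: gr0_implies_Suc)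
  qed (rule \<pi>)
  then show "contains_pattern \<sigma> \<pi>"
    unfolding contains_pattern_def U using xs by blast
qed

section \<open>Set partitions and restricted growth functions\<close>

definition block_index :: "nat set set \<Rightarrow> nat \<Rightarrow> nat" where
  "block_index \<sigma> i = (THE j. j \<in> {1..length (blocks \<sigma>)} \<and> i \<in> blocks \<sigma> ! (j - 1))"

lemma rgf_conv_map: "rgf n \<sigma> = map (block_index \<sigma>) [1..<n + 1]"
  by (simp add: rgf_def block_index_def)

lemma block_index_eqI:
  assumes "disjoint (set (blocks \<sigma>))" "distinct (blocks \<sigma>)"
    and "j \<in> {1..length (blocks \<sigma>)}" "i \<in> blocks \<sigma> ! (j - 1)"
  shows "block_index \<sigma> i = j"
  unfolding block_index_def
proof (rule the_equality)
  fix j' assume j': "j' \<in> {1..length (blocks \<sigma>)} \<and> i \<in> blocks \<sigma> ! (j' - 1)"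
  then have "blocks \<sigma> ! (j' - 1) = blocks \<sigma> ! (j - 1)"
    using assms disjointD[OF assms(1), of "blocks \<sigma> ! (j' - 1)" "blocks \<sigma> ! (j - 1)"] by fastforce
  then show "j' = j"
    using j' assms(2,3) by (auto simp: nth_eq_iff_index_eq)
qed (use assms in blast)

lemma distinct_blocks:
  assumes "partition_on {1..n} \<sigma>"
  shows "distinct (blocks \<sigma>)"
proof -
  have "sorted_wrt (<) (map Min (blocks \<sigma>))"
    using blocks_partition(2)[OF assms] by (simp add: sorted_wrt_map)
  then show ?thesis by (metis distinct_map strict_sorted_iff)
qed

lemma block_index:
  assumes \<sigma>: "partition_on {1..n} \<sigma>" and i: "i \<in> {1..n}"
  shows "block_index \<sigma> i \<in> {1..length (blocks \<sigma>)}" "i \<in> blocks \<sigma> ! (block_index \<sigma> i - 1)"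
proof -
  obtain B where "B \<in> \<sigma>" "i \<in> B" using partition_onD1[OF \<sigma>] i by blast
  then obtain j where j: "j < length (blocks \<sigma>)" "i \<in> blocks \<sigma> ! j"
    using blocks_partition(1)[OF \<sigma>] by (metis in_set_conv_nth)
  then have "block_index \<sigma> i = Suc j"
    using partition_onD2[OF \<sigma>] distinct_blocks[OF \<sigma>]
    by (intro block_index_eqI) (auto simp: blocks_partition(1)[OF \<sigma>])
  then show "block_index \<sigma> i \<in> {1..length (blocks \<sigma>)}" "i \<in> blocks \<sigma> ! (block_index \<sigma> i - 1)"
    using j by auto
qed

lemma block_index_eq_iff:
  assumes \<sigma>: "partition_on {1..n} \<sigma>" and ij: "i \<in> {1..n}" "j \<in> {1..n}"
  shows "block_index \<sigma> i = block_index \<sigma> j \<longleftrightarrow> same_block \<sigma> i j"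
proof
  assume "block_index \<sigma> i = block_index \<sigma> j"
  moreover have "blocks \<sigma> ! (block_index \<sigma> i - 1) \<in> \<sigma>"
    using block_index(1)[OF \<sigma> ij(1)] blocks_partition(1)[OF \<sigma>] by (metis One_nat_def Suc_le_lessD Suc_pred atLeastAtMost_iff nth_mem le_simps(2) Suc_le_eq)
  ultimately show "same_block \<sigma> i j"
    using block_index(2)[OF \<sigma>] ij unfolding same_block_def by metis
next
  assume "same_block \<sigma> i j"
  then obtain B where B: "B \<in> \<sigma>" "i \<in> B" "j \<in> B" unfolding same_block_def by blast
  then obtain b where b: "b < length (blocks \<sigma>)" "B = blocks \<sigma> ! b"
    using blocks_partition(1)[OF \<sigma>] by (metis in_set_conv_nth)
  have "block_index \<sigma> x = Suc b" if "x \<in> B" for x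
    using b that partition_onD2[OF \<sigma>] distinct_blocks[OF \<sigma>]
    by (intro block_index_eqI) (auto simp: blocks_partition(1)[OF \<sigma>])
  then show "block_index \<sigma> i = block_index \<sigma> j" using B by simp
qed

text \<open>The usual condition that a letter is at most one more than the maximum before it,
  phrased by splittings so that an occurrence of a letter directly yields earlier occurrences of all
  smaller ones.\<close>

definition restricted_growth :: "nat list \<Rightarrow> bool" where
  "restricted_growth w \<longleftrightarrow> (\<forall>p b q. w = p @ b # q \<longrightarrow> 0 < b \<and> {1..<b} \<subseteq> set p)"

text \<open>For \<open>c < b\<close> the block numbered \<open>c\<close> has a smaller minimum than
  the block numbered \<open>b\<close>, so the letter \<open>c\<close> is written at that minimum,
  before any letter \<open>b\<close>.\<close>

lemma restricted_growth_rgf: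
  assumes \<sigma>: "partition_on {1..n} \<sigma>"
  shows "restricted_growth (rgf n \<sigma>)"
  unfolding restricted_growth_def
proof (intro allI impI conjI subsetI)
  fix p b q assume w: "rgf n \<sigma> = p @ b # q"
  define i where "i = Suc (length p)"
  have "length (rgf n \<sigma>) = n" by (simp add: rgf_def)
  then have i: "i \<in> {1..n}" using w by (simp add: i_def)
  have nth: "rgf n \<sigma> ! (j - 1) = block_index \<sigma> j" if "j \<in> {1..n}" for j
    using that by (cases j) (auto simp: rgf_conv_map simp del: upt_Suc)
  have b: "b = block_index \<sigma> i" using nth[OF i] w by (simp add: i_def)
  then show "0 < b" using block_index(1)[OF \<sigma> i] by simp
  fix c assume c: "c \<in> {1..<b}"
  let ?C = "blocks \<sigma> ! (c - 1)" and ?B = "blocks \<sigma> ! (b - 1)"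
  have bl: "b \<le> length (blocks \<sigma>)" "i \<in> ?B" using block_index[OF \<sigma> i] b by auto
  have "Min ?C < Min ?B"
    using sorted_wrt_nth_less[OF blocks_partition(2)[OF \<sigma>], of "c - 1" "b - 1"] c bl by auto
  have in\<sigma>: "?C \<in> \<sigma>" "?B \<in> \<sigma>"
  proof -
    have "c - 1 < length (blocks \<sigma>)" "b - 1 < length (blocks \<sigma>)" using c bl by auto
    then show "?C \<in> \<sigma>" "?B \<in> \<sigma>" using nth_mem blocks_partition(1)[OF \<sigma>] by blast+
  qed
  then have fin: "finite ?B" "finite ?C" and sub: "?C \<subseteq> {1..n}"
    using partition_onD1[OF \<sigma>] by (auto intro!: finite_subset[of _ "{1..n}"])
  moreover have "?C \<noteq> {}" using in\<sigma> partition_onD3[OF \<sigma>] by metis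
  ultimately have m: "Min ?C \<in> ?C" "Min ?C \<in> {1..n}" using Min_in by blast+
  have "Min ?B \<le> i" using fin bl by simp
  then have lt: "Min ?C < i" using \<open>Min ?C < Min ?B\<close> by simp
  have "block_index \<sigma> (Min ?C) = c"
    using partition_onD2[OF \<sigma>] distinct_blocks[OF \<sigma>] c bl m
    by (intro block_index_eqI) (auto simp: blocks_partition(1)[OF \<sigma>])
  then have "rgf n \<sigma> ! (Min ?C - 1) = c" using nth[OF m(2)] by simp
  moreover have idx: "Min ?C - 1 < length p" using lt m(2) unfolding i_def atLeastAtMost_iff by linarith
  ultimately have "c = p ! (Min ?C - 1)" using w by (simp add: nth_append)
  then show "c \<in> set p" using nth_mem[OF idx] by simp
qed

lemma restricted_growth_set:
  assumes "restricted_growth w"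
  shows "set w = {1..card (set w)}"
proof -
  have pos: "0 < b" and below: "{1..<b} \<subseteq> set w" if "b \<in> set w" for b
    using that assms split_list[OF that] unfolding restricted_growth_def by fastforce+
  \<comment> \<open>Inserting 0 gives the empty word the maximum 0, so that the interval is empty
    too.\<close>
  have "set w = {1..Max (insert 0 (set w))}"
  proof (intro equalityI subsetI)
    fix x assume "x \<in> {1..Max (insert 0 (set w))}"
    moreover have "Max (insert 0 (set w)) \<in> insert 0 (set w)" by (intro Max_in) auto
    ultimately show "x \<in> set w" using below[of "Max (insert 0 (set w))"]
      by (cases "x = Max (insert 0 (set w))") auto
  qed (use pos in \<open>auto simp: Suc_le_eq\<close>)
  then show ?thesis by (metis card_atLeastAtMost diff_Suc_1)
qed

text \<open>The blocks are the level sets \<open>bl c\<close> of the word. Restricted growth puts a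
  letter \<open>c\<close> before the first \<open>d\<close> whenever \<open>c < d\<close>, so the
  minima increase and \<open>blocks\<close> lists the level sets in the order of their
  letters.\<close>

lemma restricted_growth_rgfE:
  assumes rg: "restricted_growth w"
  obtains \<sigma> where "partition_on {1..length w} \<sigma>" "rgf (length w) \<sigma> = w"
proof -
  define m where "m = card (set w)"
  define bl where "bl c = {i \<in> {1..length w}. w ! (i - 1) = c}" for c
  define \<sigma> where "\<sigma> = bl ` {1..m}"
  have set: "set w = {1..m}" using restricted_growth_set[OF rg] by (simp add: m_def)
  have in_bl: "i \<in> bl (w ! (i - 1))" "w ! (i - 1) \<in> {1..m}" if "i \<in> {1..length w}" for i
    using that set nth_mem[of "i - 1" w] by (auto simp: bl_def)
  have ne: "bl c \<noteq> {}" if c: "c \<in> {1..m}" for c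
  proof -
    obtain i where "i < length w" "w ! i = c" using c set by (metis in_set_conv_nth)
    then have "Suc i \<in> bl c" by (simp add: bl_def)
    then show ?thesis by blast
  qed
  have part: "partition_on {1..length w} \<sigma>"
  proof (rule partition_onI)
    show "\<Union>\<sigma> = {1..length w}" unfolding \<sigma>_def using in_bl by (auto simp: bl_def)
    show "disjnt p p'" if "p \<in> \<sigma>" "p' \<in> \<sigma>" "p \<noteq> p'" for p p'
      using that by (auto simp: \<sigma>_def bl_def disjnt_def)
    show "{} \<notin> \<sigma>" using ne unfolding \<sigma>_def by (metis imageE)
  qed
  have fin: "finite (bl c)" for c by (simp add: bl_def)
  have bl: "blocks \<sigma> = map bl [1..<Suc m]"
  proof (rule blocks_unique)
    show "set (map bl [1..<Suc m]) = \<sigma>" by (simp add: \<sigma>_def atLeastLessThanSuc_atLeastAtMost del: upt_Suc)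
    have "Min (bl c) < Min (bl d)" if "c \<in> {1..m}" "d \<in> {1..m}" "c < d" for c d
    proof -
      define i where "i = Min (bl d) - 1"
      have "Min (bl d) \<in> bl d" using ne[OF that(2)] fin by (intro Min_in)
      then have i: "Min (bl d) = Suc i" "i < length w" "w ! i = d" by (auto simp: bl_def i_def)
      then have "w = take i w @ d # drop (Suc i) w" by (metis id_take_nth_drop)
      then have "c \<in> set (take i w)"
        using rg that unfolding restricted_growth_def by fastforce
      then obtain j where "j < i" "w ! j = c" using i by (auto simp: in_set_conv_nth)
      then have "Suc j \<in> bl c" using i by (simp add: bl_def)
      then have "Min (bl c) \<le> Suc j" using fin by simp
      with \<open>j < i\<close> i show ?thesis by simp
    qed
    then show "sorted_wrt (\<lambda>B C. Min B < Min C) (map bl [1..<Suc m])"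
      by (auto simp: sorted_wrt_map sorted_wrt_iff_nth_less simp del: upt_Suc)
  qed
  have "rgf (length w) \<sigma> = w"
  proof (rule nth_equalityI)
    fix i assume "i < length (rgf (length w) \<sigma>)"
    then have i: "i < length w" by (simp add: rgf_def del: upt_Suc)
    then have wi: "Suc i \<in> bl (w ! i)" "w ! i \<in> {1..m}" using in_bl[of "Suc i"] by simp_all
    have "block_index \<sigma> (Suc i) = w ! i"
    proof (rule block_index_eqI)
      show "disjoint (set (blocks \<sigma>))"
        using partition_onD2[OF part] by (simp only: blocks_partition(1)[OF part])
      show "w ! i \<in> {1..length (blocks \<sigma>)}" using wi bl by simp
      have "blocks \<sigma> ! (w ! i - 1) = bl (w ! i)"
        using wi(2) by (cases "w ! i") (simp_all add: bl del: upt_Suc)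
      then show "Suc i \<in> blocks \<sigma> ! (w ! i - 1)" using wi by simp
    qed (rule distinct_blocks[OF part])
    with i show "rgf (length w) \<sigma> ! i = w ! i" by (simp add: rgf_conv_map del: upt_Suc)
  qed (simp add: rgf_def del: upt_Suc)
  then show thesis using that part by blast
qed

section \<open>Patterns as subsequences of the word\<close>

lemma subseq_map_iff: "subseq ys (map f xs) \<longleftrightarrow> (\<exists>zs. subseq zs xs \<and> ys = map f zs)"
  by (metis nths_map subseq_conv_nths)

lemma subseq_upt_iff: "subseq xs [a..<b] \<longleftrightarrow> sorted_wrt (<) xs \<and> set xs \<subseteq> {a..<b}"
proof
  assume "subseq xs [a..<b]"
  then show "sorted_wrt (<) xs \<and> set xs \<subseteq> {a..<b}"
    by (metis distinct_nthsI distinct_upt set_nths_subset set_upt sorted_nths sorted_upt strict_sorted_iff subseq_conv_nths)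
qed (simp add: sorted_subset_imp_subseq)

lemma contains_pattern_iff_rgf:
  assumes \<sigma>: "partition_on {1..n} \<sigma>" and \<pi>: "partition_on {1..k} \<pi>"
  shows "contains_pattern \<sigma> \<pi> \<longleftrightarrow>
    (\<exists>ys. subseq ys (rgf n \<sigma>) \<and> length ys = k
      \<and> (\<forall>i<k. \<forall>j<k. ys ! i = ys ! j \<longleftrightarrow> same_block \<pi> (Suc i) (Suc j)))"
proof -
  have "block_index \<sigma> (xs ! i) = block_index \<sigma> (xs ! j) \<longleftrightarrow> same_block \<sigma> (xs ! i) (xs ! j)"
    if "set xs \<subseteq> {1..n}" "i < length xs" "j < length xs" for xs i j
    using that by (intro block_index_eq_iff[OF \<sigma>]) (meson nth_mem subsetD)+
  then show ?thesis
    unfolding contains_pattern_iff[OF \<sigma> \<pi>] rgf_conv_map subseq_map_iff subseq_upt_iff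
    by (auto simp: atLeastLessThanSuc_atLeastAtMost)
qed

lemma avoiding_rgfs_eq:
  assumes \<pi>: "partition_on {1..k} \<pi>"
  shows "avoiding_rgfs n \<pi> = {w. length w = n \<and> restricted_growth w \<and>
    \<not> (\<exists>ys. subseq ys w \<and> length ys = k
      \<and> (\<forall>i<k. \<forall>j<k. ys ! i = ys ! j \<longleftrightarrow> same_block \<pi> (Suc i) (Suc j)))}"
    (is "_ = {w. _ \<and> _ \<and> \<not> ?C w}")
proof (intro equalityI subsetI)
  fix w assume "w \<in> avoiding_rgfs n \<pi>"
  then obtain \<sigma> where "partition_on {1..n} \<sigma>" "\<not> contains_pattern \<sigma> \<pi>" "w = rgf n \<sigma>"
    by (auto simp: avoiding_rgfs_def avoiding_partitions_def)
  then show "w \<in> {w. length w = n \<and> restricted_growth w \<and> \<not> ?C w}"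
    using contains_pattern_iff_rgf[OF _ \<pi>] restricted_growth_rgf by (simp add: rgf_def)
next
  fix w assume w: "w \<in> {w. length w = n \<and> restricted_growth w \<and> \<not> ?C w}"
  then obtain \<sigma> where "partition_on {1..n} \<sigma>" "rgf n \<sigma> = w"
    using restricted_growth_rgfE by blast
  then show "w \<in> avoiding_rgfs n \<pi>"
    using contains_pattern_iff_rgf[OF _ \<pi>] w by (force simp: avoiding_rgfs_def avoiding_partitions_def)
qed

lemma all_less_4: "(\<forall>i<4. P i) \<longleftrightarrow> P 0 \<and> P 1 \<and> P 2 \<and> P (3::nat)"
  by (auto simp: numeral_eq_Suc All_less_Suc)

lemma ex_length_4: "(\<exists>ys. Q ys \<and> length ys = 4 \<and> P ys)
    \<longleftrightarrow> (\<exists>a b c d. Q [a, b, c, d] \<and> P [a, b, c, d])"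
  by (auto simp: numeral_eq_Suc length_Suc_conv)

text \<open>Only equality of letters counts, not their order: a partition pattern records nothing
  but which positions share a block.\<close>

definition avoids_13_2_4 :: "nat list \<Rightarrow> bool" where
  "avoids_13_2_4 w \<longleftrightarrow> \<not> (\<exists>x y z. subseq [x, y, x, z] w \<and> x \<noteq> y \<and> x \<noteq> z \<and> y \<noteq> z)"

definition avoids_1_24_3 :: "nat list \<Rightarrow> bool" where
  "avoids_1_24_3 w \<longleftrightarrow> \<not> (\<exists>x y z. subseq [z, x, y, x] w \<and> x \<noteq> y \<and> x \<noteq> z \<and> y \<noteq> z)"

lemma avoiding_rgfs_13_2_4:
  "avoiding_rgfs n pat_13_2_4 = {w. length w = n \<and> restricted_growth w \<and> avoids_13_2_4 w}"
proof -
  have "partition_on {1..4} pat_13_2_4" by (auto simp: partition_on_def disjoint_def)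
  then show ?thesis
    unfolding avoiding_rgfs_eq[OF \<open>partition_on _ _\<close>] ex_length_4 all_less_4 avoids_13_2_4_def by (auto simp: same_block_def)
qed

lemma avoiding_rgfs_1_24_3:
  "avoiding_rgfs n pat_1_24_3 = {w. length w = n \<and> restricted_growth w \<and> avoids_1_24_3 w}"
proof -
  have "partition_on {1..4} pat_1_24_3" by (auto simp: partition_on_def disjoint_def)
  then show ?thesis
    unfolding avoiding_rgfs_eq[OF \<open>partition_on _ _\<close>] ex_length_4 all_less_4 avoids_1_24_3_def by (auto simp: same_block_def)
qed

section \<open>Direct sums and their unique decomposition\<close>

text \<open>On \<open>gapless\<close> words \<open>card (set a)\<close> is the greatest letter of
  \<open>a\<close>, which makes it the right shift.\<close>

definition direct_sum :: "nat list \<Rightarrow> nat list \<Rightarrow> nat list" (infixr \<open>\<oplus>\<close> 65) where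
  "a \<oplus> b = a @ map (\<lambda>x. x + card (set a)) b"

definition rev_compl :: "nat list \<Rightarrow> nat list" where
  "rev_compl w = rev (map (\<lambda>x. Suc (card (set w)) - x) w)"

text \<open>Weaker than restricted growth, but preserved by reverse complementation, which
  restricted growth is not: 121 becomes 212.\<close>

definition gapless :: "nat list \<Rightarrow> bool" where
  "gapless w \<longleftrightarrow> set w = {1..card (set w)}"

lemma gaplessI: "set w = {1..m} \<Longrightarrow> gapless w"
  by (simp add: gapless_def)

lemma gapless_Nil [simp]: "gapless []"
  by (simp add: gapless_def)

lemma direct_sum_Nil [simp]: "[] \<oplus> b = b" "a \<oplus> [] = a"
  by (simp_all add: direct_sum_def)

lemma length_direct_sum [simp]: "length (a \<oplus> b) = length a + length b"
  by (simp add: direct_sum_def)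

lemma gapless_le: "gapless a \<Longrightarrow> x \<in> set a \<Longrightarrow> 1 \<le> x \<and> x \<le> card (set a)"
  unfolding gapless_def by (metis atLeastAtMost_iff)

lemma stat_direct_sum:
  assumes a: "gapless a" and b: "gapless b"
  shows "ls (a \<oplus> b) = ls a + card (set a) * length b + ls b"
    "rb (a \<oplus> b) = rb a + length a * card (set b) + rb b"
    "lb (a \<oplus> b) = lb a + lb b" "rs (a \<oplus> b) = rs a + rs b"
proof -
  let ?f = "\<lambda>x. x + card (set a)"
  have less: "x < y" if "x \<in> set a" "y \<in> set (map ?f b)" for x y
    using that gapless_le[OF a] gapless_le[OF b] by fastforce
  have mono: "strict_mono ?f" by (simp add: strict_mono_def)
  have "card (?f ` set b) = card (set b)" by (intro card_image) simp
  then show "ls (a \<oplus> b) = ls a + card (set a) * length b + ls b"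
    "rb (a \<oplus> b) = rb a + length a * card (set b) + rb b"
    "lb (a \<oplus> b) = lb a + lb b" "rs (a \<oplus> b) = rs a + rs b"
    using ls_append_less[of a "map ?f b", OF less] rb_append_less[of a "map ?f b", OF less] lb_append_less[of a "map ?f b", OF less]
      rs_append_less[of a "map ?f b", OF less] stat_map_strict_mono[OF mono]
    by (simp_all add: direct_sum_def)
qed

lemma shift_atLeastAtMost: "(\<lambda>x. x + m) ` {1..n} = {Suc m..m + n}" for m n :: nat
  using image_add_atLeastAtMost[of m 1 n] by (simp add: add.commute)

lemma set_direct_sum:
  assumes a: "gapless a" and b: "gapless b"
  shows "set (a \<oplus> b) = {1..card (set a) + card (set b)}"
proof -
  have "set (a \<oplus> b) = {1..card (set a)} \<union> (\<lambda>x. x + card (set a)) ` {1..card (set b)}"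
    using a b unfolding gapless_def by (simp add: direct_sum_def)
  then show ?thesis unfolding shift_atLeastAtMost by auto
qed

lemma card_set_direct_sum:
  "gapless a \<Longrightarrow> gapless b \<Longrightarrow> card (set (a \<oplus> b)) = card (set a) + card (set b)"
  by (simp add: set_direct_sum)

lemma sorted_direct_sum:
  assumes "gapless a" "gapless b"
  shows "sorted (a \<oplus> b) \<longleftrightarrow> sorted a \<and> sorted b"
proof -
  have "sorted (map (\<lambda>x. x + card (set a)) b) \<longleftrightarrow> sorted b"
    by (simp add: sorted_map)
  then show ?thesis
    using gapless_le[OF assms(1)] by (force simp: direct_sum_def sorted_append)
qed

lemma rev_compl_Nil [simp]: "rev_compl [] = []"
  by (simp add: rev_compl_def)

lemma length_rev_compl [simp]: "length (rev_compl w) = length w"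
  by (simp add: rev_compl_def)

lemma set_rev_compl:
  assumes "gapless w"
  shows "set (rev_compl w) = set w"
proof -
  have "(\<lambda>x. Suc m - x) ` {1..m} = {1..m}" for m :: nat
    by (intro endo_inj_surj inj_on_inverseI[where g = "\<lambda>x. Suc m - x"]) auto
  then show ?thesis using assms unfolding gapless_def rev_compl_def by (metis set_map set_rev)
qed

lemma gapless_rev_compl: "gapless w \<Longrightarrow> gapless (rev_compl w)"
  by (simp add: gapless_def set_rev_compl)

lemma rev_compl_rev_compl:
  assumes "gapless w"
  shows "rev_compl (rev_compl w) = w"
proof -
  have "Suc (card (set w)) - (Suc (card (set w)) - x) = x" if "x \<in> set w" for x
    using gapless_le[OF assms that] by simp
  then show ?thesis
    by (simp add: rev_compl_def[of "rev_compl w"] set_rev_compl[OF assms])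
      (simp add: rev_compl_def rev_map map_idI)
qed

lemma stat_rev_compl:
  assumes "gapless w"
  shows "ls (rev_compl w) = rb w" "rb (rev_compl w) = ls w"
  using ls_rev_compl[of w "Suc (card (set w))"] rb_rev_compl[of w "Suc (card (set w))"]
    gapless_le[OF assms] by (auto simp: rev_compl_def le_Suc_eq)

lemma sorted_rev_compl:
  assumes "gapless w" "sorted w"
  shows "sorted (rev_compl w)"
proof -
  have "sorted_wrt (\<lambda>x y. y \<le> x) (map (\<lambda>x. Suc (card (set w)) - x) w)"
    using assms(2) by (auto simp: sorted_wrt_map elim!: sorted_wrt_mono_rel[rotated])
  then show ?thesis by (simp add: rev_compl_def sorted_wrt_rev)
qed

lemma sorted_rev_compl_iff: "gapless w \<Longrightarrow> sorted (rev_compl w) \<longleftrightarrow> sorted w"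
  by (metis gapless_rev_compl rev_compl_rev_compl sorted_rev_compl)

text \<open>The word \<open>s 1\<^sup>k\<close> of a pair \<^term>\<open>core s k\<close> is empty or unsorted. Since \<open>s\<close> does not end in 1,
  the pair is determined by the word, and since \<open>s\<close> runs from its least to its greatest letter,
  reverse complementation of \<open>s\<close> gives another core.\<close>

definition core :: "nat list \<Rightarrow> nat \<Rightarrow> bool" where
  "core s k \<longleftrightarrow> s = [] \<and> k = 0 \<or>
    gapless s \<and> 2 \<le> card (set s) \<and> hd s = 1 \<and> last s = card (set s) \<and>
    (sorted s \<or> card (set s) = 2) \<and> (sorted s \<longrightarrow> 0 < k)"

lemma core_gapless: "core s k \<Longrightarrow> gapless s"
  by (auto simp: core_def)

lemma core_rev_compl:
  assumes "core s k"
  shows "core (rev_compl s) k"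
proof (cases "s = []")
  case False
  with assms have s: "gapless s" "2 \<le> card (set s)" "hd s = 1" "last s = card (set s)"
    "sorted s \<or> card (set s) = 2" "sorted s \<longrightarrow> 0 < k"
    by (auto simp: core_def)
  have "hd (rev_compl s) = 1" "last (rev_compl s) = card (set s)"
    using False s by (simp_all add: rev_compl_def hd_rev last_rev last_map hd_map)
  with s show ?thesis
    by (simp add: core_def gapless_rev_compl set_rev_compl sorted_rev_compl_iff)
qed (use assms in simp)

lemma set_core_word:
  assumes "core s k"
  shows "set (s @ replicate k 1) = set s"
proof (cases "s = []")
  case False
  with assms have "1 \<in> set s" using hd_in_set[of s] by (auto simp: core_def)
  then show ?thesis by auto
qed (use assms in \<open>simp add: core_def\<close>)

lemma gapless_core_word: "core s k \<Longrightarrow> gapless (s @ replicate k 1)"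
  using set_core_word[of s k] core_gapless[of s k] unfolding gapless_def by metis

lemma not_sorted_core_word:
  assumes "core s k" "s \<noteq> []"
  shows "\<not> sorted (s @ replicate k 1)"
proof
  assume sorted: "sorted (s @ replicate k 1)"
  then have "sorted s" by (simp add: sorted_append)
  with assms have "0 < k" "last s \<ge> 2" by (auto simp: core_def)
  moreover have "last s \<le> 1"
    using sorted last_in_set[OF assms(2)] \<open>0 < k\<close> by (simp add: sorted_append)
  ultimately show False by simp
qed

lemma core_word_inject:
  assumes "core s k" "core s' k'" "s @ replicate k 1 = s' @ replicate k' 1"
  shows "s = s' \<and> k = k'"
proof -
  have drop_ones: "dropWhile ((=) x) (replicate k x @ ys) = dropWhile ((=) x) ys" for k x and ys :: "nat list"
    by (induction k) auto
  have strip: "dropWhile ((=) 1) (rev (s @ replicate k 1)) = rev s" if "core s k" for s k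
  proof (cases "s = []")
    case False
    then have "last s \<noteq> 1" using that by (auto simp: core_def)
    with False show ?thesis by (cases s rule: rev_cases) (simp_all add: drop_ones)
  qed (use that in \<open>simp add: core_def\<close>)
  have "rev s = rev s'" by (metis strip assms)
  then show ?thesis using assms(3) by simp
qed

text \<open>Levi's lemma for \<open>\<oplus>\<close>: the overlap \<open>t\<close> is the part of
  \<open>b\<close> covered by the longer left summand.\<close>

lemma direct_sum_eq_direct_sum:
  assumes eq: "a \<oplus> b = a' \<oplus> b'" and le: "length a \<le> length a'"
    and a: "gapless a" "gapless a'" and b: "gapless b"
  obtains t where "a' = a \<oplus> t" "b = t \<oplus> b'" "gapless t"
proof -
  let ?m = "card (set a)" and ?m' = "card (set a')"
  define c where "c = drop (length a) a'"
  have pre: "a = take (length a) a'"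
    using arg_cong[OF eq, of "take (length a)"] le by (simp add: direct_sum_def)
  then have c: "a' = a @ c" by (metis append_take_drop_id c_def)
  define t where "t = take (length c) b"
  have cb: "c @ map (\<lambda>x. x + ?m') b' = map (\<lambda>x. x + ?m) b"
    using eq unfolding direct_sum_def c by simp
  then have ct: "c = map (\<lambda>x. x + ?m) t"
    unfolding t_def by (metis append_eq_conv_conj take_map)
  have "drop (length c) (map (\<lambda>x. x + ?m) b) = map (\<lambda>x. x + ?m') b'"
    by (simp flip: cb)
  then have rest: "map (\<lambda>x. x + ?m) (drop (length c) b) = map (\<lambda>x. x + ?m') b'"
    by (simp add: drop_map)
  have a': "a' = a \<oplus> t" using c ct by (simp add: direct_sum_def)
  have sub: "?m \<le> ?m'" using c by (auto intro: card_mono)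
  have pos: "0 < x" if "x \<in> set t" for x
    using that gapless_le[OF b] set_take_subset[of "length c" b] by (fastforce simp: t_def)
  \<comment> \<open>The letters of \<open>a'\<close> fill \<open>{1..?m'}\<close>, those of
    \<open>a\<close> fill \<open>{1..?m}\<close>, and the shifted letters of \<open>t\<close> lie
    above \<open>?m\<close>; so they are exactly the rest, and \<open>t\<close> is gapless.\<close>
  have "set a' = set a \<union> (\<lambda>x. x + ?m) ` set t" by (simp add: c ct)
  then have un: "{1..?m'} = {1..?m} \<union> (\<lambda>x. x + ?m) ` set t"
    using a unfolding gapless_def by metis
  have "x \<in> set t \<longleftrightarrow> x \<in> {1..?m' - ?m}" for x
  proof -
    have "x \<in> set t \<longleftrightarrow> 0 < x \<and> x + ?m \<in> (\<lambda>x. x + ?m) ` set t" using pos by auto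
    also have "\<dots> \<longleftrightarrow> 0 < x \<and> x + ?m \<in> {1..?m'}" unfolding un by auto
    finally show ?thesis using sub by auto
  qed
  then have t: "set t = {1..?m' - ?m}" by blast
  then have "map (\<lambda>x. x + ?m) (drop (length c) b) = map (\<lambda>x. x + ?m) (map (\<lambda>x. x + card (set t)) b')"
    using rest sub by (simp add: comp_def)
  then have "drop (length c) b = map (\<lambda>x. x + card (set t)) b'"
    by (rule map_injective) (simp add: inj_def)
  then have "b = t \<oplus> b'"
    unfolding direct_sum_def t_def by (metis append_take_drop_id)
  with a' gaplessI[OF t] show thesis using that by blast
qed

text \<open>Irreducibility makes the factor \<open>s 1\<^sup>k\<close> of a direct sum with a sorted word unique, whichever
  side it stands on.\<close>

lemma core_word_irreducible:
  assumes core: "core s k" and eq: "s @ replicate k 1 = a \<oplus> b" and a: "gapless a" and b: "gapless b"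
  shows "a = [] \<or> b = []"
proof (rule ccontr)
  assume "\<not> (a = [] \<or> b = [])"
  then have ne: "a \<noteq> []" "b \<noteq> []" by auto
  then have pos: "0 < card (set a)" "0 < card (set b)" by (auto simp: card_gt_0_iff)
  \<comment> \<open>A nonempty second summand ends above 1, which excludes trailing ones and leaves
    only an unsorted two-letter core. Two letters shared by two nonempty summands make each summand
    constant, and then the sum is sorted.\<close>
  have last: "last (a \<oplus> b) > 1"
    using ne pos gapless_le[OF b, of "last b"] by (simp add: direct_sum_def last_map)
  have k: "k = 0"
  proof (rule ccontr)
    assume "k \<noteq> 0"
    then have "last (s @ replicate k 1) = 1" by simp
    with last eq show False by simp
  qed
  with eq ne core have "card (set s) = 2" "\<not> sorted s" by (auto simp: core_def direct_sum_def)
  then have sum: "card (set a) + card (set b) = 2" and "\<not> sorted (a \<oplus> b)"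
    using eq k card_set_direct_sum[OF a b] by auto
  have "card (set a) = 1" "card (set b) = 1" using sum pos by linarith+
  then have "sorted a" "sorted b"
    using a b unfolding gapless_def by (metis atLeastAtMost_singleton replicate_length_same singletonD sorted_replicate)+
  then show False using \<open>\<not> sorted (a \<oplus> b)\<close> sorted_direct_sum[OF a b] by simp
qed

text \<open>A common parameter set for both classes: equidistribution reduces to comparing the
  statistics of two words built from related codes.\<close>

definition codes :: "nat \<Rightarrow> (nat list \<times> nat list \<times> nat) set" where
  "codes n = {(r, s, k). gapless r \<and> sorted r \<and> core s k \<and> length r + length s + k = n}"

definition word_13_2_4 :: "nat list \<times> nat list \<times> nat \<Rightarrow> nat list" where
  "word_13_2_4 = (\<lambda>(r, s, k). r \<oplus> (s @ replicate k 1))"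

definition word_1_24_3 :: "nat list \<times> nat list \<times> nat \<Rightarrow> nat list" where
  "word_1_24_3 = (\<lambda>(r, s, k). (s @ replicate k 1) \<oplus> r)"

lemma sorted_core_word: "core s k \<Longrightarrow> sorted (s @ replicate k 1) \<longleftrightarrow> s = [] \<and> k = 0"
  using not_sorted_core_word[of s k] by (cases "s = []") (auto simp: core_def)

text \<open>The overlap \<open>t\<close> of two decompositions is sorted, being a summand of
  \<open>r'\<close>. Irreducibility of \<open>?u = t \<oplus> ?u'\<close> makes \<open>t\<close> or
  \<open>?u'\<close> empty; in the second case \<open>?u = t\<close> is a sorted core word, hence
  empty as well.\<close>

lemma inj_on_word_13_2_4: "inj_on word_13_2_4 (codes n)"
proof -
  have main: "r = r' \<and> s = s' \<and> k = k'"
    if r: "gapless r" "sorted r" and r': "gapless r'" "sorted r'" and core: "core s k" "core s' k'"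
      and eq: "r \<oplus> (s @ replicate k 1) = r' \<oplus> (s' @ replicate k' 1)" and le: "length r \<le> length r'"
    for r s k r' s' k'
  proof -
    let ?u = "s @ replicate k 1" and ?u' = "s' @ replicate k' 1"
    note gap = gapless_core_word[OF core(1)] gapless_core_word[OF core(2)]
    obtain t where t: "r' = r \<oplus> t" "?u = t \<oplus> ?u'" "gapless t"
      by (rule direct_sum_eq_direct_sum[OF eq le r(1) r'(1) gap(1)])
    have "sorted t" using r' t sorted_direct_sum[OF r(1) t(3)] by simp
    consider "t = []" | "?u' = []" using core_word_irreducible[OF core(1) t(2,3) gap(2)] by blast
    then have "t = []"
    proof cases
      case 2
      then have "?u = t" using t(2) by simp
      then have "sorted ?u" using \<open>sorted t\<close> by simp
      then show ?thesis using sorted_core_word[OF core(1)] \<open>?u = t\<close> by simp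
    qed
    then show ?thesis using t core_word_inject[OF core] by simp
  qed
  show ?thesis
  proof (rule inj_onI)
    fix p p' assume p: "p \<in> codes n" "p' \<in> codes n" and eq: "word_13_2_4 p = word_13_2_4 p'"
    obtain r s k r' s' k' where [simp]: "p = (r, s, k)" "p' = (r', s', k')" by (metis prod_cases3)
    show "p = p'"
    proof (cases "length r \<le> length r'")
      case True
      then show ?thesis using main[of r r' s k s' k'] p eq by (simp add: codes_def word_13_2_4_def)
    next
      case False
      then show ?thesis using main[of r' r s' k' s k] p eq by (simp add: codes_def word_13_2_4_def)
    qed
  qed
qed

text \<open>Now the core words stand on the left, so the overlap belongs to the longer core word
  \<open>?u'\<close> and to \<open>r\<close>, and irreducibility is applied to
  \<open>?u'\<close>.\<close>

lemma inj_on_word_1_24_3: "inj_on word_1_24_3 (codes n)"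
proof -
  have main: "r = r' \<and> s = s' \<and> k = k'"
    if r: "gapless r" "sorted r" and r': "gapless r'" "sorted r'" and core: "core s k" "core s' k'"
      and eq: "(s @ replicate k 1) \<oplus> r = (s' @ replicate k' 1) \<oplus> r'"
      and le: "length (s @ replicate k 1) \<le> length (s' @ replicate k' 1)"
    for r s k r' s' k'
  proof -
    let ?u = "s @ replicate k 1" and ?u' = "s' @ replicate k' 1"
    note gap = gapless_core_word[OF core(1)] gapless_core_word[OF core(2)]
    obtain t where t: "?u' = ?u \<oplus> t" "r = t \<oplus> r'" "gapless t"
      by (rule direct_sum_eq_direct_sum[OF eq le gap r(1)])
    have "sorted t" using r t sorted_direct_sum[OF t(3) r'(1)] by simp
    consider "?u = []" | "t = []" using core_word_irreducible[OF core(2) t(1) gap(1) t(3)] by blast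
    then have "t = []"
    proof cases
      case 1
      then have "?u' = t" using t(1) by simp
      then have "sorted ?u'" using \<open>sorted t\<close> by simp
      then show ?thesis using sorted_core_word[OF core(2)] \<open>?u' = t\<close> by simp
    qed
    then show ?thesis using t core_word_inject[OF core] by simp
  qed
  show ?thesis
  proof (rule inj_onI)
    fix p p' assume p: "p \<in> codes n" "p' \<in> codes n" and eq: "word_1_24_3 p = word_1_24_3 p'"
    obtain r s k r' s' k' where [simp]: "p = (r, s, k)" "p' = (r', s', k')" by (metis prod_cases3)
    show "p = p'"
    proof (cases "length s + k \<le> length s' + k'")
      case True
      then show ?thesis using main[of r r' s k s' k'] p eq by (simp add: codes_def word_1_24_3_def)
    next
      case False
      then show ?thesis using main[of r' r s' k' s k] p eq by (simp add: codes_def word_1_24_3_def)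
    qed
  qed
qed

section \<open>The words avoiding the two patterns\<close>

lemma restricted_growth_Nil [simp]: "restricted_growth []"
  by (simp add: restricted_growth_def)

lemma restricted_growth_snoc:
  "restricted_growth (w @ [x]) \<longleftrightarrow> restricted_growth w \<and> 0 < x \<and> {1..<x} \<subseteq> set w"
proof
  assume rg: "restricted_growth (w @ [x])"
  have "0 < b \<and> {1..<b} \<subseteq> set p" if "w = p @ b # q" for p b q
    using rg that unfolding restricted_growth_def by (metis append_Cons append_assoc)
  moreover have "0 < x \<and> {1..<x} \<subseteq> set w" using rg unfolding restricted_growth_def by blast
  ultimately show "restricted_growth w \<and> 0 < x \<and> {1..<x} \<subseteq> set w"
    unfolding restricted_growth_def by blast
next
  assume rg: "restricted_growth w \<and> 0 < x \<and> {1..<x} \<subseteq> set w"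
  show "restricted_growth (w @ [x])"
    unfolding restricted_growth_def
  proof (intro allI impI)
    fix p b q assume "w @ [x] = p @ b # q"
    then show "0 < b \<and> {1..<b} \<subseteq> set p"
      using rg unfolding restricted_growth_def by (cases q rule: rev_cases) auto
  qed
qed

lemma restricted_growth_appendD: "restricted_growth (a @ b) \<Longrightarrow> restricted_growth a"
  by (induction b rule: rev_induct) (simp_all flip: append_assoc add: restricted_growth_snoc)

lemma restricted_growthD: "restricted_growth (p @ b # q) \<Longrightarrow> 0 < b \<and> {1..<b} \<subseteq> set p"
  unfolding restricted_growth_def by blast

lemma restricted_growth_hd: "restricted_growth w \<Longrightarrow> w \<noteq> [] \<Longrightarrow> hd w = 1"
  using restricted_growthD[of "[]" "hd w" "tl w"] by (cases "hd w \<le> 1") auto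

lemma gapless_restricted_growth: "restricted_growth w \<Longrightarrow> gapless w"
  using restricted_growth_set unfolding gapless_def .

lemma restricted_growth_sorted:
  assumes "gapless w" "sorted w"
  shows "restricted_growth w"
  unfolding restricted_growth_def
proof (intro allI impI)
  fix p b q assume w: "w = p @ b # q"
  then have b: "b \<in> {1..card (set w)}" using assms(1) gapless_le by fastforce
  have "c \<in> set p" if c: "c \<in> {1..<b}" for c
  proof -
    have "c \<in> {1..card (set w)}" using b c by auto
    then have "c \<in> set w" using assms(1) unfolding gapless_def by metis
    then show ?thesis using assms(2) c w by (auto simp: sorted_append)
  qed
  then show "0 < b \<and> {1..<b} \<subseteq> set p" using b by auto
qed

lemma restricted_growth_replicate_1:
  "restricted_growth w \<Longrightarrow> restricted_growth (w @ replicate k 1)"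
  by (induction k) (simp_all flip: replicate_append_same append_assoc add: restricted_growth_snoc)

lemma restricted_growth_core:
  assumes "core s k"
  shows "restricted_growth s"
proof (cases "s = [] \<or> sorted s")
  case True
  then show ?thesis using assms core_gapless restricted_growth_sorted by auto
next
  case False
  with assms have s: "card (set s) = 2" "gapless s" "hd s = 1" by (auto simp: core_def)
  show ?thesis unfolding restricted_growth_def
  proof (intro allI impI)
    fix p b q assume w: "s = p @ b # q"
    then have "b = 1 \<or> b = 2" using gapless_le[OF s(2), of b] s(1) by auto
    moreover have "1 \<in> set p" if "b = 2"
      using that s(3) w by (cases p) auto
    moreover have "{1..<1 :: nat} = {}" "{1..<2 :: nat} = {1}" by auto
    ultimately show "0 < b \<and> {1..<b} \<subseteq> set p"
      by (metis empty_subsetI insert_subset zero_less_numeral zero_less_one)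
  qed
qed

lemma restricted_growth_direct_sum:
  assumes a: "restricted_growth a" and b: "restricted_growth b"
  shows "restricted_growth (a \<oplus> b)"
  using b
proof (induction b rule: rev_induct)
  case (snoc x b)
  let ?m = "card (set a)"
  have x: "0 < x" "{1..<x} \<subseteq> set b" and "restricted_growth (a \<oplus> b)"
    using snoc by (auto simp: restricted_growth_snoc)
  moreover have "{1..<x + ?m} \<subseteq> set (a \<oplus> b)"
  proof
    fix c assume c: "c \<in> {1..<x + ?m}"
    show "c \<in> set (a \<oplus> b)"
    proof (cases "c \<le> ?m")
      case True
      then have "c \<in> set a" using c restricted_growth_set[OF a] by (metis atLeastAtMost_iff atLeastLessThan_iff)
      then show ?thesis by (simp add: direct_sum_def)
    next
      case False
      then have "c - ?m \<in> {1..<x}" using c by auto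
      then have "c - ?m \<in> set b" using x by blast
      then show ?thesis using False by (force simp: direct_sum_def)
    qed
  qed
  moreover have "a \<oplus> (b @ [x]) = (a \<oplus> b) @ [x + ?m]" by (simp add: direct_sum_def)
  ultimately show ?case by (simp add: restricted_growth_snoc)
qed (use a in simp)

section \<open>Words built from codes avoid the patterns\<close>

lemma sorted_subseq: "sorted w \<Longrightarrow> subseq v w \<Longrightarrow> sorted v"
  using sorted_nths subseq_conv_nths by metis

lemma subseq_append4:
  assumes "a \<in> set A" "b \<in> set B" "c \<in> set C" "d \<in> set D"
  shows "subseq [a, b, c, d] (A @ B @ C @ D)"
proof -
  have "subseq ([a] @ [b] @ [c] @ [d]) (A @ B @ C @ D)"
    using assms by (intro list_emb_append_mono) (simp_all add: subseq_singleton_left)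
  then show ?thesis by simp
qed

lemma subseq_set: "subseq v w \<Longrightarrow> set v \<subseteq> set w"
  by (metis set_nths_subset subseq_conv_nths)

lemma card_three_le:
  assumes "finite S" "{x, y, z} \<subseteq> S" "x \<noteq> y" "x \<noteq> z" "y \<noteq> z"
  shows "3 \<le> card S"
  using card_mono[OF assms(1,2)] assms(3-5) by simp

text \<open>Both patterns use three letters, which leaves the case of a sorted \<open>s\<close>.
  There the second \<open>x\<close> must be a trailing one, so \<open>x = 1\<close>. In
  \<open>x y x z\<close> the final \<open>z\<close> is then 1 too. In \<open>z x y x\<close> either
  \<open>y\<close> is also a trailing one, or \<open>z\<close> precedes \<open>x = 1\<close> inside
  the sorted \<open>s\<close> and equals 1.\<close>

lemma core_word_avoids:
  assumes core: "core s k"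
  shows "avoids_13_2_4 (s @ replicate k 1)" "avoids_1_24_3 (s @ replicate k 1)"
proof -
  let ?u = "s @ replicate k 1"
  have three: "sorted s" if "x \<in> set ?u" "y \<in> set ?u" "z \<in> set ?u" "x \<noteq> y" "x \<noteq> z" "y \<noteq> z" for x y z
    using card_three_le[of "set s" x y z] that core unfolding set_core_word[OF core]
    by (cases "s = []") (auto simp: core_def)
  have one: "x = 1" if "x \<in> set (replicate k 1)" for x :: nat using that by auto
  have pos: "1 \<le> x" if "x \<in> set s" for x using gapless_le[OF core_gapless[OF core] that] by simp
  show "avoids_13_2_4 ?u"
    unfolding avoids_13_2_4_def
  proof (intro notI, elim exE conjE)
    fix x y z assume sub: "subseq [x, y, x, z] ?u" and ne: "x \<noteq> y" "x \<noteq> z" "y \<noteq> z"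
    then have sorted: "sorted s" using subseq_set[OF sub] three[of x y z] by simp
    obtain v v' where v: "[x, y, x, z] = v @ v'" "subseq v s" "subseq v' (replicate k 1)"
      using sub by (rule subseq_appendE)
    note sub1 = sorted_subseq[OF sorted v(2)] and sub2 = subseq_set[OF v(3)]
    show False
      using v(1) sub1 sub2 one ne
      by (auto simp: Cons_eq_append_conv)
  qed
  show "avoids_1_24_3 ?u"
    unfolding avoids_1_24_3_def
  proof (intro notI, elim exE conjE)
    fix x y z assume sub: "subseq [z, x, y, x] ?u" and ne: "x \<noteq> y" "x \<noteq> z" "y \<noteq> z"
    then have sorted: "sorted s" using subseq_set[OF sub] three[of x y z] by simp
    obtain v v' where v: "[z, x, y, x] = v @ v'" "subseq v s" "subseq v' (replicate k 1)"
      using sub by (rule subseq_appendE)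
    note sub1 = sorted_subseq[OF sorted v(2)] and sub2 = subseq_set[OF v(3)] and sub3 = subseq_set[OF v(2)]
    show False
      using v(1) sub1 sub2 sub3 one ne pos[of z]
      by (auto simp: Cons_eq_append_conv)
  qed
qed

lemma direct_sum_disjoint:
  assumes a: "gapless a" and b: "gapless b"
  shows "set a \<inter> set (map (\<lambda>x. x + card (set a)) b) = {}"
  using gapless_le[OF a] gapless_le[OF b] by fastforce

text \<open>The two copies of \<open>x\<close> lie in the same summand, and not in the sorted
  \<open>r\<close> since \<open>x y x\<close> is unsorted. So the first \<open>x\<close>, and with
  it the whole occurrence, lies in the shifted \<open>u\<close>.\<close>

lemma avoids_13_2_4_direct_sum:
  assumes gap: "gapless r" "gapless u" and r: "sorted r" and u: "avoids_13_2_4 u"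
  shows "avoids_13_2_4 (r \<oplus> u)"
  unfolding avoids_13_2_4_def
proof (intro notI, elim exE conjE)
  define u' where "u' = map (\<lambda>x. x + card (set r)) u"
  have disj: "x \<noteq> y" if "x \<in> set r" "y \<in> set u'" for x y
    using direct_sum_disjoint[OF gap] that unfolding u'_def by blast
  fix x y z assume sub: "subseq [x, y, x, z] (r \<oplus> u)" and ne: "x \<noteq> y" "x \<noteq> z" "y \<noteq> z"
  obtain v v' where v: "[x, y, x, z] = v @ v'" "subseq v r" "subseq v' u'"
    using sub unfolding direct_sum_def u'_def by (rule subseq_appendE)
  have "v = []"
    using v(1) sorted_subseq[OF r v(2)] subseq_set[OF v(2)] subseq_set[OF v(3)] disj[of x x] ne
    by (auto simp: Cons_eq_append_conv)
  then have "subseq [x, y, x, z] u'" using v by simp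
  then have "\<exists>zs. subseq zs u \<and> [x, y, x, z] = map (\<lambda>x. x + card (set r)) zs"
    unfolding u'_def subseq_map_iff .
  then obtain zs where zs: "subseq zs u" "[x, y, x, z] = map (\<lambda>x. x + card (set r)) zs"
    by (elim exE conjE)
  then obtain x' y' z' where "zs = [x', y', x', z']" "x' \<noteq> y'" "x' \<noteq> z'" "y' \<noteq> z'"
    using ne by (auto simp: map_eq_Cons_conv Cons_eq_map_conv)
  then show False using zs u unfolding avoids_13_2_4_def by blast
qed

text \<open>Mirror argument: the last \<open>x\<close> lies in \<open>u\<close>, hence so does
  everything before it.\<close>

lemma avoids_1_24_3_direct_sum:
  assumes gap: "gapless u" "gapless r" and r: "sorted r" and u: "avoids_1_24_3 u"
  shows "avoids_1_24_3 (u \<oplus> r)"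
  unfolding avoids_1_24_3_def
proof (intro notI, elim exE conjE)
  define r' where "r' = map (\<lambda>x. x + card (set u)) r"
  have disj: "x \<noteq> y" if "x \<in> set u" "y \<in> set r'" for x y
    using direct_sum_disjoint[OF gap] that unfolding r'_def by blast
  fix x y z assume sub: "subseq [z, x, y, x] (u \<oplus> r)" and ne: "x \<noteq> y" "x \<noteq> z" "y \<noteq> z"
  obtain v v' where v: "[z, x, y, x] = v @ v'" "subseq v u" "subseq v' r'"
    using sub unfolding direct_sum_def r'_def by (rule subseq_appendE)
  have "sorted r'" using r by (simp add: r'_def sorted_map)
  have "v' = []"
    using v(1) sorted_subseq[OF \<open>sorted r'\<close> v(3)] subseq_set[OF v(2)] subseq_set[OF v(3)] disj[of x x] ne
    by (auto simp: Cons_eq_append_conv)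
  then show False using v u ne unfolding avoids_1_24_3_def by auto
qed

section \<open>Decomposing an avoiding word at a descent\<close>

lemma sorted_le_last: "sorted w \<Longrightarrow> y \<in> set w \<Longrightarrow> y \<le> last w"
  by (cases w rule: rev_cases) (auto simp: sorted_append)

lemma not_sorted_first_descent:
  "\<not> sorted w \<Longrightarrow> \<exists>p x q. w = p @ x # q \<and> p \<noteq> [] \<and> x < last p \<and> sorted p" for w :: "nat list"
proof (induction w rule: rev_induct)
  case (snoc x w)
  show ?case
  proof (cases "sorted w")
    case True
    with snoc.prems obtain y where y: "y \<in> set w" "x < y" by (auto simp: sorted_append)
    then have "w \<noteq> []" "y \<le> last w" using True sorted_le_last by auto
    with y True show ?thesis by (intro exI[of _ w] exI[of _ x] exI[of _ "[]"]) auto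
  next
    case False
    then show ?thesis using snoc.IH by (metis append_Cons append_assoc)
  qed
qed simp

lemma not_sorted_last_descent:
  "\<not> sorted w \<Longrightarrow> \<exists>p x q. w = p @ x # q \<and> p \<noteq> [] \<and> x < last p \<and> sorted (x # q)" for w :: "nat list"
proof (induction w)
  case (Cons y w)
  show ?case
  proof (cases "sorted w")
    case True
    with Cons.prems obtain z where "z \<in> set w" "z < y" by (auto simp: not_le)
    then obtain x q where w: "w = x # q" by (cases w) auto
    with True \<open>z \<in> set w\<close> \<open>z < y\<close> have "x < y" by auto
    with True w show ?thesis by (intro exI[of _ "[y]"] exI[of _ x] exI[of _ q]) auto
  next
    case False
    then show ?thesis using Cons.IH by (metis append_Cons last_ConsR list.distinct(1))
  qed
qed simp

lemma sorted_filter_append: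
  "sorted w \<Longrightarrow> filter (\<lambda>v. v < x) w @ filter (\<lambda>v. x \<le> v) w = w" for x :: nat
proof (induction w)
  case (Cons y w)
  show ?case
  proof (cases "y < x")
    case False
    then have "filter (\<lambda>v. v < x) w = []" "filter (\<lambda>v. x \<le> v) w = w"
      using Cons.prems by (auto simp: filter_empty_conv filter_id_conv)
    with False show ?thesis by simp
  qed (use Cons in simp)
qed simp

lemma sorted_gapless_last:
  assumes "gapless w" "sorted w" "w \<noteq> []"
  shows "last w = card (set w)"
proof (rule antisym)
  show "last w \<le> card (set w)" using gapless_le[OF assms(1)] assms(3) by simp
  have "card (set w) \<in> set w"
    using assms unfolding gapless_def
    by (metis One_nat_def atLeastAtMost_iff card_gt_0_iff finite_set le_refl set_empty Suc_leI)
  then show "card (set w) \<le> last w"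
    using sorted_le_last[OF assms(2)] by simp
qed

text \<open>Stripping every trailing 1 leaves an \<open>s\<close> that does not end in 1. Its last
  letter is then the greatest one: by order if \<open>s\<close> is sorted, and as the only other
  letter if \<open>s\<close> is binary.\<close>

lemma core_exists:
  assumes u: "gapless u" "\<not> sorted u" "hd u = 1"
    and shape: "(\<exists>p j. u = p @ replicate j 1 \<and> sorted p) \<or> card (set u) = 2"
  shows "\<exists>s k. core s k \<and> u = s @ replicate k 1"
proof -
  define s where "s = rev (dropWhile ((=) 1) (rev u))"
  define k where "k = length (takeWhile ((=) 1) (rev u))"
  have "takeWhile ((=) 1) (rev u) = replicate k 1"
    unfolding k_def by (rule replicate_length_same[symmetric]) (auto dest: set_takeWhileD)
  then have "rev u = replicate k 1 @ rev s"
    unfolding s_def rev_rev_ident by (metis takeWhile_dropWhile_id)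
  then have u_eq: "u = s @ replicate k 1" by (simp add: rev_swap)
  have s: "s \<noteq> []" using u(2) u_eq by auto
  then have last: "last s \<noteq> 1"
    using hd_dropWhile[of "(=) 1" "rev u"] by (auto simp: s_def last_rev)
  have hd: "hd s = 1" using u(3) u_eq s by simp
  have "1 \<in> set s" using hd hd_in_set[OF s] by simp
  then have set: "set u = set s" using u_eq by auto
  then have gap: "gapless s" using u(1) unfolding gapless_def by metis
  have "card {1, last s} \<le> card (set s)" using \<open>1 \<in> set s\<close> s by (intro card_mono) auto
  then have card: "2 \<le> card (set s)" using last by simp
  have sorted: "sorted s \<or> card (set s) = 2"
  proof (rule disjE[OF shape])
    assume "\<exists>p j. u = p @ replicate j 1 \<and> sorted p"
    then obtain p j where p: "u = p @ replicate j 1" "sorted p" by blast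
    \<comment> \<open>Letters of \<open>s\<close> beyond \<open>p\<close> would all be ones,
      contradicting the last letter of \<open>s\<close>; so \<open>s\<close> is a prefix of the
      sorted \<open>p\<close>.\<close>
    have "length s \<le> length p"
    proof (rule ccontr)
      assume len: "\<not> length s \<le> length p"
      then have "drop (length p) s @ replicate k 1 = replicate j 1"
        using u_eq p(1) by (metis append_eq_conv_conj drop_append diff_is_0_eq nle_le drop0)
      then have "set (drop (length p) s) \<subseteq> {1}" by (metis Un_subset_iff set_append set_replicate_conv_if subset_singleton_iff empty_subsetI order_refl)
      moreover have "last s \<in> set (drop (length p) s)" using len by (metis last_drop last_in_set drop_eq_Nil not_le)
      ultimately show False using last by auto
    qed
    then have "s = take (length s) p" using u_eq p(1) by (metis append_eq_append_conv_if)
    then have "sorted s" using p(2) sorted_wrt_take by metis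
    then show ?thesis ..
  qed (simp add: set)
  have "last s = card (set s)"
  proof (cases "sorted s")
    case False
    then show ?thesis using sorted gapless_le[OF gap, of "last s"] s last by simp
  qed (use sorted_gapless_last[OF gap] s in simp)
  moreover have "0 < k" if "sorted s" using that u(2) u_eq by (cases k) auto
  ultimately have "core s k" using gap card hd sorted by (simp add: core_def)
  then show ?thesis using u_eq by blast
qed

lemma restricted_growth_core_word: "core s k \<Longrightarrow> restricted_growth (s @ replicate k 1)"
  using restricted_growth_core restricted_growth_replicate_1 by blast

lemma mem_gapless: "gapless w \<Longrightarrow> x \<in> set w \<longleftrightarrow> 1 \<le> x \<and> x \<le> card (set w)"
  unfolding gapless_def by (metis atLeastAtMost_iff)

lemma gapless_iff: "gapless w \<longleftrightarrow> (\<exists>m. set w = {1..m})"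
  unfolding gapless_def by (metis card_atLeastAtMost diff_Suc_1)

lemma card_gapless: "set w = {1..m} \<Longrightarrow> card (set w) = m"
  by simp

lemma shift_down_image: "(\<lambda>v. v - m) ` {Suc m..n} = {1..n - m}" for m n :: nat
proof -
  have "x \<in> (\<lambda>v. v - m) ` {Suc m..n}" if "x \<in> {1..n - m}" for x
    using that by (intro image_eqI[of _ _ "x + m"]) auto
  then show ?thesis by auto
qed

lemma append_eq_direct_sum:
  assumes "gapless a" "\<And>v. v \<in> set c \<Longrightarrow> card (set a) < v"
  shows "a @ c = a \<oplus> map (\<lambda>v. v - card (set a)) c"
proof -
  have "map (\<lambda>v. v - card (set a) + card (set a)) c = c"
    by (rule map_idI) (use assms(2) in \<open>simp add: less_imp_le\<close>)
  then show ?thesis by (simp add: direct_sum_def comp_def)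
qed

lemma image_word_13_2_4: "word_13_2_4 ` codes n = avoiding_rgfs n pat_13_2_4"
proof (intro equalityI subsetI)
  fix w assume "w \<in> word_13_2_4 ` codes n"
  then obtain r s k where p: "gapless r" "sorted r" "core s k" "length r + length s + k = n"
    and w: "w = r \<oplus> (s @ replicate k 1)"
    by (auto simp: codes_def word_13_2_4_def)
  have "restricted_growth w"
    unfolding w using p restricted_growth_direct_sum restricted_growth_sorted restricted_growth_core_word
    by blast
  moreover have "avoids_13_2_4 w"
    unfolding w using p avoids_13_2_4_direct_sum core_word_avoids gapless_core_word by blast
  ultimately show "w \<in> avoiding_rgfs n pat_13_2_4"
    unfolding avoiding_rgfs_13_2_4 using p by (simp add: w)
next
  fix w assume "w \<in> avoiding_rgfs n pat_13_2_4"
  then have len: "length w = n" and rg: "restricted_growth w" and av: "avoids_13_2_4 w"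
    unfolding avoiding_rgfs_13_2_4 by simp_all
  have "\<exists>r s k. gapless r \<and> sorted r \<and> core s k \<and> w = r \<oplus> (s @ replicate k 1)"
  proof (cases "sorted w")
    case True
    have "core [] 0" by (simp add: core_def)
    then show ?thesis
      using True gapless_restricted_growth[OF rg]
      by (intro exI[of _ w] exI[of _ "[]"] exI[of _ 0]) simp
  next
    case False
    then obtain p x q where w: "w = p @ x # q" and p: "p \<noteq> []" "x < last p" "sorted p"
      using not_sorted_first_descent by blast
    define M where "M = card (set p)"
    have gap: "gapless p" using rg w restricted_growth_appendD gapless_restricted_growth by blast
    then have set_p: "set p = {1..M}" by (simp add: gapless_def M_def)
    have M: "last p = M" using sorted_gapless_last[OF gap p(3,1)] by (simp add: M_def)
    have x: "1 \<le> x" "x < M" using restricted_growthD[of p x q] rg w p(2) M by auto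
    \<comment> \<open>The letters of the sorted prefix below the descent letter \<open>x\<close>
      become \<open>r\<close>; everything after them is shifted down by \<open>x - 1\<close>, so
      that \<open>x\<close> becomes the letter 1 of \<open>u\<close>.\<close>
    define r where "r = filter (\<lambda>v. v < x) p"
    define h where "h = filter (\<lambda>v. x \<le> v) p"
    define c where "c = h @ x # q"
    have p_eq: "p = r @ h" using sorted_filter_append[OF p(3), of x] by (simp add: r_def h_def)
    \<comment> \<open>The prefix holds \<open>x\<close> and then \<open>y\<close>, and the descent
      repeats \<open>x\<close>; a later \<open>z\<close> distinct from both would complete
      \<open>x y x z\<close>.\<close>
    have q: "z = x \<or> z = y" if z: "z \<in> set q" and y: "y \<in> {x<..M}" for y z
    proof (rule ccontr)
      assume ne: "\<not> (z = x \<or> z = y)"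
      let ?a = "filter (\<lambda>v. v < Suc x) p" and ?b = "filter (\<lambda>v. Suc x \<le> v) p"
      have "subseq [x, y, x, z] (?a @ ?b @ [x] @ q)"
        using x y z set_p by (intro subseq_append4) auto
      moreover have "?a @ ?b @ [x] @ q = w"
        using sorted_filter_append[OF p(3), of "Suc x"] w by (simp flip: append_assoc)
      moreover have "x \<noteq> y" using y by simp
      ultimately show False using av ne unfolding avoids_13_2_4_def by metis
    qed
    have set_r: "set r = {1..x - 1}" using set_p x by (auto simp: r_def)
    have gap_r: "gapless r" using set_r by (rule gaplessI)
    have card_r: "card (set r) = x - 1" using set_r by (rule card_gapless)
    have sorted_r: "sorted r" using p(3) by (simp add: r_def sorted_filter[of id, simplified])
    have sorted_h: "sorted h" using p(3) by (simp add: h_def sorted_filter[of id, simplified])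
    have set_h: "set h = {x..M}" using set_p x by (auto simp: h_def)
    have "set q \<subseteq> {x, M}" using q[of _ M] x by auto
    then have set_c: "set c = {Suc (x - 1)..M}" using set_h x by (auto simp: c_def)
    define u where "u = map (\<lambda>v. v - (x - 1)) c"
    have "r @ c = r \<oplus> u"
      unfolding u_def card_r[symmetric]
      by (rule append_eq_direct_sum[OF gap_r]) (use set_c card_r in auto)
    then have w_eq: "w = r \<oplus> u" using w p_eq by (simp add: c_def)
    have set_u: "set u = {1..M - (x - 1)}"
      unfolding u_def set_map set_c by (rule shift_down_image)
    have gap_u: "gapless u" using set_u by (rule gaplessI)
    have "h \<noteq> []" using set_h x by auto
    have "x \<in> set h" using set_h x by simp
    then have "hd h \<le> x" using sorted_h by (cases h) auto
    moreover have "x \<le> hd h" using hd_in_set[OF \<open>h \<noteq> []\<close>] set_h by simp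
    ultimately have "hd h = x" by simp
    then have hd: "hd u = 1" using \<open>h \<noteq> []\<close> x by (simp add: u_def c_def hd_append hd_map)
    have unsorted: "\<not> sorted u"
      using False sorted_r w_eq sorted_direct_sum[OF gap_r gap_u] by simp
    have "(\<exists>p j. u = p @ replicate j 1 \<and> sorted p) \<or> card (set u) = 2"
    \<comment> \<open>If \<open>M = Suc x\<close>, only two letters remain. Otherwise
      \<open>Suc x\<close> and \<open>M\<close> are two different choices of \<open>y\<close>, and
      every letter after the descent must be \<open>x\<close>.\<close>
    proof (cases "M = Suc x")
      case True
      then show ?thesis using card_gapless[OF set_u] x by simp
    next
      case False
      then have "z = x" if "z \<in> set q" for z using q[OF that, of "Suc x"] q[OF that, of M] x by auto
      then have "replicate (length q) x = q" by (intro replicate_length_same) simp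
      then have "map (\<lambda>v. v - (x - 1)) (x # q) = replicate (Suc (length q)) 1"
        using x by (metis diff_diff_cancel list.map(2) map_replicate replicate_Suc)
      then have "u = map (\<lambda>v. v - (x - 1)) h @ replicate (Suc (length q)) 1"
        by (simp add: u_def c_def)
      moreover have "sorted (map (\<lambda>v. v - (x - 1)) h)"
        using sorted_h by (auto simp: sorted_map elim!: sorted_wrt_mono_rel[rotated])
      ultimately show ?thesis by blast
    qed
    from core_exists[OF gap_u unsorted hd this]
    show ?thesis using gap_r sorted_r w_eq by blast
  qed
  then show "w \<in> word_13_2_4 ` codes n"
    using len by (force simp: codes_def word_13_2_4_def)
qed

text \<open>Let \<open>y = last p\<close>. If \<open>x\<close> were not 1, an earlier
  \<open>x\<close>, itself preceded by 1, would give \<open>1 x y x\<close>. A letter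
  \<open>z > y\<close> in \<open>p\<close> would have \<open>y\<close> before it and 1 before that,
  giving \<open>1 y z y\<close>. The lemma applies at any descent, and is used for the last one of
  the word and for one inside its prefix.\<close>

lemma descent_avoids_1_24_3:
  assumes rg: "restricted_growth (p @ x # q)" and av: "avoids_1_24_3 (p @ x # q)"
    and p: "p \<noteq> []" "x < last p"
  shows "x = 1" "set p = {1..last p}"
proof -
  define y where "y = last p"
  obtain p' where p': "p = p' @ [y]" using p(1) by (metis append_butlast_last_id y_def)
  have rgp: "restricted_growth p" using rg restricted_growth_appendD by blast
  have below: "{1..<y} \<subseteq> set p'" using restricted_growthD[of p' y "[]"] rgp p' by simp
  have x: "0 < x" "x < y" using restricted_growthD[OF rg] p(2) by (auto simp: y_def)
  show "x = 1"
  proof (rule ccontr)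
    assume "x \<noteq> 1"
    have "x \<in> set p'" using below x by auto
    then obtain a b where ab: "p' = a @ x # b" by (meson split_list)
    then have "1 \<in> set a" using restricted_growthD[of a x "b @ y # x # q"] rg p' x \<open>x \<noteq> 1\<close> by auto
    then have "subseq [1, x, y, x] (a @ (x # b) @ [y] @ x # q)" by (intro subseq_append4) auto
    then have "subseq [1, x, y, x] (p @ x # q)" using ab p' by simp
    moreover have "x \<noteq> y" "y \<noteq> 1" using x by auto
    ultimately show False using av \<open>x \<noteq> 1\<close> unfolding avoids_1_24_3_def by blast
  qed
  have "z \<le> y" if "z \<in> set p" for z
  proof (rule ccontr)
    assume z: "\<not> z \<le> y"
    then have "z \<in> set p'" using that p' by auto
    then obtain a b where ab: "p' = a @ z # b" by (meson split_list)
    then have "y \<in> set a" using restricted_growthD[of a z "b @ y # x # q"] rg p' x z by auto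
    then obtain a1 a2 where a: "a = a1 @ y # a2" by (meson split_list)
    then have "1 \<in> set a1"
      using restricted_growthD[of a1 y "a2 @ z # b @ y # x # q"] rg p' ab x by auto
    then have "subseq [1, y, z, y] (a1 @ (y # a2) @ (z # b) @ y # x # q)" by (intro subseq_append4) auto
    then have "subseq [1, y, z, y] (p @ x # q)" using ab a p' by simp
    moreover have "y \<noteq> 1" "y \<noteq> z" "z \<noteq> 1" using x z by auto
    ultimately show False using av unfolding avoids_1_24_3_def by blast
  qed
  moreover have "1 \<le> z" if "z \<in> set p" for z
    using mem_gapless[OF gapless_restricted_growth[OF rgp]] that by simp
  moreover have "{1..y} \<subseteq> set p" using below p' by (auto simp: nat_less_le)
  ultimately show "set p = {1..last p}" unfolding y_def[symmetric] by auto
qed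

lemma image_word_1_24_3: "word_1_24_3 ` codes n = avoiding_rgfs n pat_1_24_3"
proof (intro equalityI subsetI)
  fix w assume "w \<in> word_1_24_3 ` codes n"
  then obtain r s k where p: "gapless r" "sorted r" "core s k" "length r + length s + k = n"
    and w: "w = (s @ replicate k 1) \<oplus> r"
    by (auto simp: codes_def word_1_24_3_def)
  have "restricted_growth w"
    unfolding w using p restricted_growth_direct_sum restricted_growth_sorted restricted_growth_core_word
    by blast
  moreover have "avoids_1_24_3 w"
    unfolding w using p avoids_1_24_3_direct_sum core_word_avoids gapless_core_word by blast
  ultimately show "w \<in> avoiding_rgfs n pat_1_24_3"
    unfolding avoiding_rgfs_1_24_3 using p by (simp add: w)
next
  fix w assume "w \<in> avoiding_rgfs n pat_1_24_3"
  then have len: "length w = n" and rg: "restricted_growth w" and av: "avoids_1_24_3 w"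
    unfolding avoiding_rgfs_1_24_3 by simp_all
  have "\<exists>r s k. gapless r \<and> sorted r \<and> core s k \<and> w = (s @ replicate k 1) \<oplus> r"
  proof (cases "sorted w")
    case True
    have "core [] 0" by (simp add: core_def)
    then show ?thesis
      using True gapless_restricted_growth[OF rg]
      by (intro exI[of _ w] exI[of _ "[]"] exI[of _ 0]) simp
  next
    case False
    then obtain p x q where w: "w = p @ x # q" and p: "p \<noteq> []" "x < last p" and xq: "sorted (x # q)"
      using not_sorted_last_descent by blast
    define y where "y = last p"
    have x: "x = 1" and set_p: "set p = {1..y}"
      using descent_avoids_1_24_3[of p x q] rg av w p by (auto simp: y_def)
    have y: "2 \<le> y" using p(2) x by (simp add: y_def)
    obtain p' where p': "p = p' @ [y]" using p(1) by (metis append_butlast_last_id y_def)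
    have rgp: "restricted_growth p" using rg w restricted_growth_appendD by blast
    have below: "{1..<y} \<subseteq> set p'" using restricted_growthD[of p' y "[]"] rgp p' by simp
    \<comment> \<open>From \<open>3 \<le> y\<close> on, 2 is a letter of \<open>p'\<close> other
      than 1 and \<open>y\<close>, so a return of \<open>y\<close> gives \<open>2 y 1 y\<close>. A
      return of an intermediate \<open>z\<close> gives \<open>1 z y z\<close>.\<close>
    have q: "z = 1 \<or> y < z" if z: "z \<in> set q" and y3: "3 \<le> y" for z
    proof (rule ccontr)
      assume nz: "\<not> (z = 1 \<or> y < z)"
      have "0 < z" using z w mem_gapless[OF gapless_restricted_growth[OF rg], of z] by simp
      show False
      proof (cases "z = y")
        case True
        have "subseq [2, y, 1, y] (p' @ [y] @ [1] @ q)"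
          using below y3 True z by (intro subseq_append4) auto
        then have "subseq [2, y, 1, y] w" using w p' x by simp
        moreover have "y \<noteq> 1" "y \<noteq> 2" "(1 :: nat) \<noteq> 2" using y3 by auto
        ultimately show False using av unfolding avoids_1_24_3_def by metis
      next
        case False
        then have "z \<in> set p'" using below nz \<open>0 < z\<close> by auto
        then obtain a b where ab: "p' = a @ z # b" by (meson split_list)
        then have "1 \<in> set a"
          using restricted_growthD[of a z "b @ [y]"] rgp p' nz \<open>0 < z\<close> by auto
        then have "subseq [1, z, y, z] (a @ (z # b) @ [y] @ 1 # q)"
          using z by (intro subseq_append4) auto
        then have "subseq [1, z, y, z] w" using w p' x ab by simp
        moreover have "z \<noteq> 1" "y \<noteq> 1" using nz y by auto
        ultimately show False using av False unfolding avoids_1_24_3_def by blast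
      qed
    qed
    \<comment> \<open>A descent inside \<open>p\<close> would drop from some \<open>z\<close> to 1,
      with \<open>y\<close> still to come at the end of \<open>p\<close>. If \<open>z = y\<close>
      this yields \<open>2 y 1 y\<close>; otherwise the ones of the two descents yield
      \<open>z 1 y 1\<close>.\<close>
    have sorted_p: "sorted p" if y3: "3 \<le> y"
    proof (rule ccontr)
      assume "\<not> sorted p"
      then obtain a b c where abc: "p = a @ b # c" and a: "a \<noteq> []" "b < last a"
        using not_sorted_last_descent by blast
      have "w = a @ b # (c @ x # q)" using w abc by simp
      then have b: "b = 1" and set_a: "set a = {1..last a}"
        using descent_avoids_1_24_3[of a b "c @ x # q"] rg av a by simp_all
      define z where "z = last a"
      obtain a' where a': "a = a' @ [z]" using a(1) by (metis append_butlast_last_id z_def)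
      have z: "1 < z" using a(2) b by (simp add: z_def)
      have "c \<noteq> []" using abc b y3 p' by auto
      then have yc: "y \<in> set c" using abc p' by (metis last_ConsR last_appendR last_in_set last_snoc list.distinct(1))
      show False
      proof (cases "z = y")
        case True
        have "{1..<z} \<subseteq> set a'"
          using restricted_growthD[of a' z "b # c"] rgp abc a' by simp
        then have "subseq [2, y, 1, y] (a' @ [y] @ [1] @ c)"
          using y3 True yc by (intro subseq_append4) auto
        then have "subseq [2, y, 1, y] (a @ b # c)" using a' b True by simp
        then have "subseq [2, y, 1, y] w" unfolding w abc by (rule list_emb_append_mono[of _ _ _ "[]" "x # q", simplified])
        moreover have "y \<noteq> 1" "y \<noteq> 2" "(1 :: nat) \<noteq> 2" using y3 by auto
        ultimately show False using av unfolding avoids_1_24_3_def by metis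
      next
        case False
        have "subseq [z, 1, y, 1] (a @ [1] @ c @ (1 # q))"
          using yc a' by (intro subseq_append4) auto
        then have "subseq [z, 1, y, 1] w" using w abc b x by simp
        moreover have "(1 :: nat) \<noteq> y" "1 \<noteq> z" using z y3 by auto
        ultimately show False using av False unfolding avoids_1_24_3_def by metis
      qed
    qed
    \<comment> \<open>The tail \<open>q\<close> after the last descent is sorted, so it splits into
      letters up to \<open>y\<close>, which stay in \<open>u\<close>, and letters above
      \<open>y\<close>, which become \<open>r\<close>.\<close>
    define g where "g = filter (\<lambda>v. v < Suc y) q"
    define t where "t = filter (\<lambda>v. Suc y \<le> v) q"
    define u where "u = p @ 1 # g"
    define r where "r = map (\<lambda>v. v - y) t"
    have q_eq: "q = g @ t"
      using sorted_filter_append[of q "Suc y"] xq by (simp add: g_def t_def)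
    have w_eq: "w = u @ t" using w x q_eq by (simp add: u_def)
    have pos: "0 < v" if "v \<in> set w" for v
      using mem_gapless[OF gapless_restricted_growth[OF rg]] that by simp
    have "set g \<subseteq> {1..y}" using pos w by (auto simp: g_def Suc_le_eq)
    then have set_u: "set u = {1..y}" using set_p y by (auto simp: u_def)
    have gap_u: "gapless u" using set_u by (rule gaplessI)
    have card_u: "card (set u) = y" using set_u by (rule card_gapless)
    have w_sum: "w = u \<oplus> r"
      unfolding w_eq r_def card_u[symmetric]
      by (rule append_eq_direct_sum[OF gap_u]) (simp add: card_u, simp add: t_def)
    have "sorted t" using xq by (simp add: t_def sorted_filter[of id, simplified])
    then have sorted_r: "sorted r"
      by (auto simp: r_def sorted_map elim!: sorted_wrt_mono_rel[rotated])
    obtain N where N: "set w = {1..N}" using gapless_restricted_growth[OF rg] by (auto simp: gapless_iff)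
    have "set t = {Suc y..N}"
    proof -
      have "set t = set w - {1..y}" using set_u by (auto simp: w_eq t_def)
      then show ?thesis using N by auto
    qed
    then have "set r = {1..N - y}" unfolding r_def set_map by (simp only: shift_down_image)
    then have gap_r: "gapless r" by (rule gaplessI)
    have hd: "hd u = 1"
      using restricted_growth_hd[OF rg] p(1) w by (simp add: u_def)
    have unsorted: "\<not> sorted u"
      using False sorted_r w_sum sorted_direct_sum[OF gap_u gap_r] by simp
    have "(\<exists>p j. u = p @ replicate j 1 \<and> sorted p) \<or> card (set u) = 2"
    proof (cases "3 \<le> y")
      case True
      then have "z = 1" if "z \<in> set g" for z using q[of z] that by (auto simp: g_def)
      then have "replicate (length g) 1 = g" by (intro replicate_length_same) simp
      then have "u = p @ replicate (Suc (length g)) 1" by (simp add: u_def)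
      then show ?thesis using sorted_p[OF True] by blast
    qed (use card_u y in simp)
    from core_exists[OF gap_u unsorted hd this]
    show ?thesis using gap_r sorted_r w_sum by blast
  qed
  then show "w \<in> word_1_24_3 ` codes n"
    using len by (force simp: codes_def word_1_24_3_def)
qed

section \<open>The equidistributions\<close>

definition rev_compl_code :: "nat list \<times> nat list \<times> nat \<Rightarrow> nat list \<times> nat list \<times> nat" where
  "rev_compl_code = (\<lambda>(r, s, k). (rev_compl r, rev_compl s, k))"

lemma bij_betw_rev_compl_code: "bij_betw rev_compl_code (codes n) (codes n)"
proof (rule bij_betw_byWitness[where f' = rev_compl_code])
  show "\<forall>p\<in>codes n. rev_compl_code (rev_compl_code p) = p"
    "\<forall>p\<in>codes n. rev_compl_code (rev_compl_code p) = p"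
    by (auto simp: codes_def rev_compl_code_def rev_compl_rev_compl core_gapless)
  show "rev_compl_code ` codes n \<subseteq> codes n" "rev_compl_code ` codes n \<subseteq> codes n"
    by (auto simp: codes_def rev_compl_code_def gapless_rev_compl sorted_rev_compl core_rev_compl)
qed

lemma stat_core_word:
  assumes "core s k"
  shows "ls (s @ replicate k 1) = ls s" "rb (s @ replicate k 1) = rb s"
proof -
  have "\<forall>x\<in>set s. 1 \<le> x" using gapless_le[OF core_gapless[OF assms]] by simp
  then show "ls (s @ replicate k 1) = ls s" "rb (s @ replicate k 1) = rb s"
    by (intro ls_append_replicate_least rb_append_replicate_least; assumption)+
qed

text \<open>The cross term of \<open>ls\<close> for \<open>r \<oplus> u\<close> is
  \<open>card (set r) * length u\<close>, and that of \<open>rb\<close> after the exchange is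
  \<open>length u * card (set r)\<close>; reverse complementation preserves lengths and letter sets,
  so they agree. \<open>lb\<close> and \<open>rs\<close> have no cross term, so there the code
  itself is kept.\<close>

lemma stat_words:
  assumes "p \<in> codes n"
  shows "ls (word_13_2_4 p) = rb (word_1_24_3 (rev_compl_code p))"
    "rb (word_13_2_4 p) = ls (word_1_24_3 (rev_compl_code p))"
    "lb (word_13_2_4 p) = lb (word_1_24_3 p)"
    "rs (word_13_2_4 p) = rs (word_1_24_3 p)"
proof -
  obtain r s k where p: "p = (r, s, k)" and r: "gapless r" "sorted r" and core: "core s k"
    using assms by (auto simp: codes_def)
  note core' = core_rev_compl[OF core]
  note gap = r(1) gapless_core_word[OF core] and gap' = gapless_core_word[OF core'] gapless_rev_compl[OF r(1)]
  show "ls (word_13_2_4 p) = rb (word_1_24_3 (rev_compl_code p))"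
    "rb (word_13_2_4 p) = ls (word_1_24_3 (rev_compl_code p))"
    unfolding p word_13_2_4_def word_1_24_3_def rev_compl_code_def prod.case
      stat_direct_sum[OF gap] stat_direct_sum[OF gap']
      stat_core_word[OF core] stat_core_word[OF core'] set_core_word[OF core] set_core_word[OF core']
      stat_rev_compl[OF r(1)] stat_rev_compl[OF core_gapless[OF core]]
      set_rev_compl[OF r(1)] set_rev_compl[OF core_gapless[OF core]]
    by simp_all
  show "lb (word_13_2_4 p) = lb (word_1_24_3 p)" "rs (word_13_2_4 p) = rs (word_1_24_3 p)"
    unfolding p word_13_2_4_def word_1_24_3_def prod.case
      stat_direct_sum[OF gap] stat_direct_sum[OF gap(2,1)] by simp_all
qed

lemma card_Collect_image_inj:
  assumes "inj_on f P"
  shows "card {w \<in> f ` P. Q w} = card {p \<in> P. Q (f p)}"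
proof -
  have "{w \<in> f ` P. Q w} = f ` {p \<in> P. Q (f p)}" by auto
  moreover have "inj_on f {p \<in> P. Q (f p)}" using assms by (rule inj_on_subset) auto
  ultimately show ?thesis by (simp add: card_image)
qed

lemma equidistributedI:
  assumes "inj_on f P" "f ` P = avoiding_rgfs n \<pi>" "inj_on g P" "g ` P = avoiding_rgfs n \<pi>'"
    and "\<And>p. p \<in> P \<Longrightarrow> st (f p) = st' (g p)"
  shows "equidistributed n st \<pi> st' \<pi>'"
  unfolding equidistributed_def assms(2,4)[symmetric]
    card_Collect_image_inj[OF assms(1)] card_Collect_image_inj[OF assms(3)]
proof
  fix k :: int
  have "{p \<in> P. int (st (f p)) = k} = {p \<in> P. int (st' (g p)) = k}" using assms(5) by auto
  then show "card {p \<in> P. int (st (f p)) = k} = card {p \<in> P. int (st' (g p)) = k}" by simp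
qed

theorem theorem5p1:
  fixes n :: nat
  assumes "n \<ge> 1"
  shows "equidistributed n ls pat_13_2_4 rb pat_1_24_3
       \<and> equidistributed n rb pat_13_2_4 ls pat_1_24_3
       \<and> equidistributed n lb pat_13_2_4 lb pat_1_24_3
       \<and> equidistributed n rs pat_13_2_4 rs pat_1_24_3"
proof -
  \<comment> \<open>Reverse complementation permutes the codes, so composing with it only re-indexes
    the second class.\<close>
  have inj: "inj_on (word_1_24_3 \<circ> rev_compl_code) (codes n)"
    using bij_betw_rev_compl_code inj_on_word_1_24_3
    by (intro comp_inj_on) (simp_all add: bij_betw_def)
  have image: "(word_1_24_3 \<circ> rev_compl_code) ` codes n = avoiding_rgfs n pat_1_24_3"
    using bij_betw_rev_compl_code[of n] image_word_1_24_3[of n]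
    unfolding bij_betw_def image_comp[symmetric] by metis
  note swap = equidistributedI[OF inj_on_word_13_2_4 image_word_13_2_4 inj image]
  note same = equidistributedI[OF inj_on_word_13_2_4 image_word_13_2_4 inj_on_word_1_24_3 image_word_1_24_3]
  show ?thesis
    by (intro conjI swap same) (simp_all add: stat_words)
qed

end
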